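(* For ${\rm APP}=\{{\rm APP}_d\}_{d\in\mathbb N}$ in the average case setting with the absolute error criterion, ${\rm APP}$ is ALG-UWT for $\Lambda^{\rm all}$ if and only if it is ALG-UWT for $\Lambda^{\rm std}$.
   Context: Setting (average case approximation). For each $d\in\mathbb N$: $D_d\subset\mathbb R^d$ is a Borel set of positive Lebesgue measure, $\rho_d$ is a probability density on $D_d$, and $G_d=L_2(D_d,\rho_d(x)\,dx)$. $F_d$ is a separable Banach space of real-valued functions on $D_d$, continuously embedded in $G_d$, such that every point evaluation $f\mapsto f(x)$, $x\in D_d$, is a continuous linear functional on $F_d$; $F_d$ carries a zero-mean Gaussian measure $\mu_d$. ${\rm APP}_d:F_d\to G_d$, ${\rm APP}_d f=f$. $\Lambda^{\rm all}$ is the class of all continuous linear functionals on $F_d$, $\Lambda^{\rm std}$ the class of point evaluations. For $\Lambda\in\{\Lambda^{\rm all},\Lambda^{\rm std}\}$, an algorithm is $A_{n,d}f=\phi_{n,d}(L_1(f),\dots,L_n(f))$ with $L_i\in\Lambda$ and $\phi_{n,d}:\mathbb R^n\to G_d$ measurable; its average case error is $e^{\rm avg}(A_{n,d})=\big(\int_{F_d}\|f-A_{n,d}f\|_{G_d}^2\,\mu_d(df)\big)^{1/2}$, and $e^{\rm avg}(n,d;\Lambda)$ is the infimum of $e^{\rm avg}(A_{n,d})$ over all such algorithms using $n$ functionals from $\Lambda$ (for $n=0$, $A_{0,d}=0$). Absolute-error information complexity: $n^{\rm ABS}(\varepsilon,d;\Lambda)=\min\{n\ge0:\ e^{\rm avg}(n,d;\Lambda)\le\varepsilon\}$.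 ALG-UWT for $\Lambda$: for all $\alpha,\beta>0$, $\lim_{\varepsilon^{-1}+d\to\infty}\frac{\ln n^{\rm ABS}(\varepsilon,d;\Lambda)}{\varepsilon^{-\alpha}+d^{\beta}}=0$, where the limit means: for every $\eta>0$ there is $M$ such that the quotient is $<\eta$ for all $d\in\mathbb N$, $\varepsilon\in(0,1)$ with $\varepsilon^{-1}+d>M$. *)

theory Defs
  imports "HOL-Probability.Probability"
begin

text \<open>Points of R^d are represented as extensional functions nat => real supported
  on {..<d}, i.e. elements of the space of the product measure
  Pi_M {..<d} (lambda _. lborel), which is Lebesgue measure on R^d (on Borel sets).
  Elements of F_d are real functions on such points.\<close>

type_synonym pt = "nat \<Rightarrow> real"
type_synonym fn = "pt \<Rightarrow> real"

definition lebesgue_d :: "nat \<Rightarrow> pt measure" where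
  "lebesgue_d d = Pi\<^sub>M {..<d} (\<lambda>_. lborel)"

text \<open>The measure rho_d(x) dx restricted to D_d; G_d = L_2 of this measure.\<close>
definition weight_measure :: "nat \<Rightarrow> pt set \<Rightarrow> (pt \<Rightarrow> real) \<Rightarrow> pt measure" where
  "weight_measure d D \<rho> = density (lebesgue_d d) (\<lambda>x. indicator D x * ennreal (\<rho> x))"

definition normed_fun_space :: "fn set \<Rightarrow> (fn \<Rightarrow> real) \<Rightarrow> bool" where
  "normed_fun_space F nF \<longleftrightarrow>
     (\<lambda>_. 0) \<in> F \<and>
     (\<forall>f\<in>F. \<forall>g\<in>F. (\<lambda>x. f x + g x) \<in> F) \<and>
     (\<forall>c. \<forall>f\<in>F. (\<lambda>x. c * f x) \<in> F) \<and>
     (\<forall>f\<in>F. 0 \<le> nF f) \<and>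
     (\<forall>f\<in>F. nF f = 0 \<longleftrightarrow> f = (\<lambda>_. 0)) \<and>
     (\<forall>f\<in>F. \<forall>g\<in>F. nF (\<lambda>x. f x + g x) \<le> nF f + nF g) \<and>
     (\<forall>c. \<forall>f\<in>F. nF (\<lambda>x. c * f x) = \<bar>c\<bar> * nF f)"

definition banach_fun_space :: "fn set \<Rightarrow> (fn \<Rightarrow> real) \<Rightarrow> bool" where
  "banach_fun_space F nF \<longleftrightarrow>
     normed_fun_space F nF \<and>
     (\<forall>s. (\<forall>k. s k \<in> F) \<and>
          (\<forall>e>0. \<exists>N. \<forall>m\<ge>N. \<forall>k\<ge>N. nF (\<lambda>x. s m x - s k x) < e) \<longrightarrow>
          (\<exists>g\<in>F. (\<lambda>k. nF (\<lambda>x. s k x - g x)) \<longlonglongrightarrow> 0))"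

definition separable_fun_space :: "fn set \<Rightarrow> (fn \<Rightarrow> real) \<Rightarrow> bool" where
  "separable_fun_space F nF \<longleftrightarrow>
     (\<exists>S. countable S \<and> S \<subseteq> F \<and> (\<forall>f\<in>F. \<forall>e>0. \<exists>g\<in>S. nF (\<lambda>x. f x - g x) < e))"

definition norm_open :: "fn set \<Rightarrow> (fn \<Rightarrow> real) \<Rightarrow> fn set \<Rightarrow> bool" where
  "norm_open F nF U \<longleftrightarrow> U \<subseteq> F \<and>
     (\<forall>f\<in>U. \<exists>e>0. \<forall>g\<in>F. nF (\<lambda>x. g x - f x) < e \<longrightarrow> g \<in> U)"

definition borel_fun_space :: "fn set \<Rightarrow> (fn \<Rightarrow> real) \<Rightarrow> fn measure" where
  "borel_fun_space F nF = sigma F {U. norm_open F nF U}"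

definition Lambda_all :: "fn set \<Rightarrow> (fn \<Rightarrow> real) \<Rightarrow> (fn \<Rightarrow> real) set" where
  "Lambda_all F nF = {L.
     (\<forall>f\<in>F. \<forall>g\<in>F. L (\<lambda>x. f x + g x) = L f + L g) \<and>
     (\<forall>c. \<forall>f\<in>F. L (\<lambda>x. c * f x) = c * L f) \<and>
     (\<exists>C. \<forall>f\<in>F. \<bar>L f\<bar> \<le> C * nF f)}"

definition Lambda_std :: "pt set \<Rightarrow> (fn \<Rightarrow> real) set" where
  "Lambda_std D = {(\<lambda>f. f x) | x. x \<in> D}"

definition gaussian_measure :: "fn set \<Rightarrow> (fn \<Rightarrow> real) \<Rightarrow> fn measure \<Rightarrow> bool" where
  "gaussian_measure F nF \<mu> \<longleftrightarrow>
     prob_space \<mu> \<and> space \<mu> = F \<and> sets \<mu> = sets (borel_fun_space F nF) \<and>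
     (\<forall>L\<in>Lambda_all F nF.
        (\<exists>\<sigma>>0. distributed \<mu> lborel L (\<lambda>t. ennreal (normal_density 0 \<sigma> t))) \<or>
        (L \<in> borel_measurable \<mu> \<and> (AE f in \<mu>. L f = 0)))"

definition avg_setting ::
  "nat \<Rightarrow> pt set \<Rightarrow> (pt \<Rightarrow> real) \<Rightarrow> fn set \<Rightarrow> (fn \<Rightarrow> real) \<Rightarrow> fn measure \<Rightarrow> bool" where
  "avg_setting d D \<rho> F nF \<mu> \<longleftrightarrow>
     D \<in> sets (lebesgue_d d) \<and> emeasure (lebesgue_d d) D > 0 \<and>
     \<rho> \<in> borel_measurable (lebesgue_d d) \<and> (\<forall>x\<in>D. 0 \<le> \<rho> x) \<and>
     (\<integral>\<^sup>+ x. indicator D x * ennreal (\<rho> x) \<partial>lebesgue_d d) = 1 \<and>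
     banach_fun_space F nF \<and> separable_fun_space F nF \<and>
     \<comment> \<open>elements of F are functions on D (represented as vanishing outside D)\<close>
     (\<forall>f\<in>F. \<forall>x. x \<notin> D \<longrightarrow> f x = 0) \<and>
     \<comment> \<open>continuous embedding of F into G = L_2(D, rho(x) dx)\<close>
     (\<forall>f\<in>F. f \<in> borel_measurable (lebesgue_d d)) \<and>
     (\<exists>C. \<forall>f\<in>F. (\<integral>\<^sup>+ x. ennreal ((f x)\<^sup>2) \<partial>weight_measure d D \<rho>) \<le> ennreal ((C * nF f)\<^sup>2)) \<and>
     (\<forall>f\<in>F. (AE x in weight_measure d D \<rho>. f x = 0) \<longrightarrow> (\<forall>x\<in>D. f x = 0)) \<and>
     \<comment> \<open>point evaluations are continuous\<close>
     (\<forall>x\<in>D. \<exists>C. \<forall>f\<in>F. \<bar>f x\<bar> \<le> C * nF f) \<and>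
     gaussian_measure F nF \<mu>"

text \<open>Admissible algorithms using n functionals from the class Lam:
  A f = phi (L_0 f, ..., L_(n-1) f), with phi : R^n -> G_d measurable (rendered as
  jointly measurable with square-integrable sections).\<close>
definition admissible_alg ::
  "nat \<Rightarrow> pt set \<Rightarrow> (pt \<Rightarrow> real) \<Rightarrow> (fn \<Rightarrow> real) set \<Rightarrow> nat \<Rightarrow>
   (nat \<Rightarrow> fn \<Rightarrow> real) \<Rightarrow> ((nat \<Rightarrow> real) \<Rightarrow> pt \<Rightarrow> real) \<Rightarrow> bool" where
  "admissible_alg d D \<rho> Lam n L \<phi> \<longleftrightarrow>
     (\<forall>i<n. L i \<in> Lam) \<and>
     (\<lambda>(y, x). \<phi> y x) \<in> borel_measurable ((Pi\<^sub>M {..<n} (\<lambda>_. borel)) \<Otimes>\<^sub>M lebesgue_d d) \<and>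
     (\<forall>y \<in> space (Pi\<^sub>M {..<n} (\<lambda>_. (borel :: real measure))).
        (\<integral>\<^sup>+ x. ennreal ((\<phi> y x)\<^sup>2) \<partial>weight_measure d D \<rho>) < \<infinity>)"

definition alg_err_sq ::
  "nat \<Rightarrow> pt set \<Rightarrow> (pt \<Rightarrow> real) \<Rightarrow> fn measure \<Rightarrow> nat \<Rightarrow>
   (nat \<Rightarrow> fn \<Rightarrow> real) \<Rightarrow> ((nat \<Rightarrow> real) \<Rightarrow> pt \<Rightarrow> real) \<Rightarrow> ennreal" where
  "alg_err_sq d D \<rho> \<mu> n L \<phi> =
     (\<integral>\<^sup>+ f. (\<integral>\<^sup>+ x. ennreal ((f x - \<phi> (restrict (\<lambda>i. L i f) {..<n}) x)\<^sup>2)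
              \<partial>weight_measure d D \<rho>) \<partial>\<mu>)"

text \<open>Squared n-th minimal average case error e^avg(n,d;Lam)^2 (A_0 = 0 for n = 0).\<close>
definition min_err_sq ::
  "nat \<Rightarrow> pt set \<Rightarrow> (pt \<Rightarrow> real) \<Rightarrow> fn measure \<Rightarrow> (fn \<Rightarrow> real) set \<Rightarrow> nat \<Rightarrow> ennreal" where
  "min_err_sq d D \<rho> \<mu> Lam n =
     (if n = 0 then (\<integral>\<^sup>+ f. (\<integral>\<^sup>+ x. ennreal ((f x)\<^sup>2) \<partial>weight_measure d D \<rho>) \<partial>\<mu>)
      else (INF (L, \<phi>) \<in> {(L, \<phi>). admissible_alg d D \<rho> Lam n L \<phi>}. alg_err_sq d D \<rho> \<mu> n L \<phi>))"

text \<open>Absolute-error information complexity: least n with e^avg(n,d) <= eps,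
  expressed through squared errors (e <= eps iff e^2 <= eps^2 for eps > 0).
  The argument esq n d is the squared n-th minimal error in dimension d.\<close>
definition n_ABS :: "(nat \<Rightarrow> nat \<Rightarrow> ennreal) \<Rightarrow> real \<Rightarrow> nat \<Rightarrow> nat" where
  "n_ABS esq \<epsilon> d = (LEAST n. esq n d \<le> ennreal (\<epsilon>\<^sup>2))"

definition ALG_UWT :: "(nat \<Rightarrow> nat \<Rightarrow> ennreal) \<Rightarrow> bool" where
  "ALG_UWT esq \<longleftrightarrow>
     (\<forall>\<alpha>>0. \<forall>\<beta>>0. \<forall>\<eta>>0. \<exists>M. \<forall>d\<ge>1. \<forall>\<epsilon>::real.
        0 < \<epsilon> \<and> \<epsilon> < 1 \<and> 1 / \<epsilon> + real d > M \<longrightarrow>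
          (\<exists>n. esq n d \<le> ennreal (\<epsilon>\<^sup>2)) \<and>
          ln (real (n_ABS esq \<epsilon> d)) / (\<epsilon> powr (-\<alpha>) + real d powr \<beta>) < \<eta>)"

end

theory Submission
  imports Defs "Jordan_Normal_Form.Determinant"
begin

text \<open>Suppose that an algorithm using \<open>n\<close> arbitrary functionals has mean square error \<open>\<tau>\<close>.
  For a Gaussian measure, a functional that is uncorrelated with the information is independent of
  it, so replacing the algorithm by the conditional expectation, which is linear in the information,
  does not increase the error; hence the \<open>L\<^sub>2\<close>-projection onto some space \<open>V\<close> of dimension
  \<open>m \<le> n\<close> also has mean square error at most \<open>\<tau>\<close>.  Weighted least squares in \<open>V\<close> from
  \<open>32 m\<^sup>3\<close> suitable sample points reproduces \<open>V\<close> exactly and therefore has mean square error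
  at most \<open>3 \<tau>\<close>, with no dependence on the possibly huge initial error.  The information complexity
  of standard information at \<open>3 \<epsilon>\<close> is thus bounded by a cubic polynomial of that of general
  information at \<open>\<epsilon>\<close>, which uniform weak tractability with an absolute error does not notice.\<close>

subsection \<open>Characteristic functions\<close>

text \<open>Nothing bounds the initial error as a function of \<open>d\<close>, so a sample size or
  an error factor involving it could not be absorbed. This is why sampling must be exact on
  \<open>V\<close>: only the residual after projection is then subject to sampling error. Two
  obstacles shape the Gaussian part. First, \<open>\<mu>\<close> is given through the
  one-dimensional laws of its functionals, and an algorithm need not be square-integrable over
  \<open>f\<close>. Independence is therefore replaced by what is really used: an uncorrelated
  functional \<open>r\<close> is orthogonal in \<open>L_2(\<mu>)\<close> to every square-integrable
  function of the information. This comes from the bounded odd weights \<open>sin (s * r f)\<close>,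
  whose pairing with every exponential of the information vanishes, by letting \<open>s\<close> tend
  to 0. Second, finiteness of the initial error is not part of the setting; it is derived from the
  Gaussian fourth moments. The factor between \<open>\<epsilon>\<close> and
  \<open>3 * \<epsilon>\<close> comes from \<open>2 * 3 \<le> 3\<^sup>2\<close>: a near-minimal
  algorithm stands in for an infimum that need not be attained, at the price of 2 in the squared
  error, and sampling costs 3.\<close>

lemma (in prob_space) integrable_bounded_cmod:
  fixes w :: "'a \<Rightarrow> complex"
  assumes "w \<in> borel_measurable M" "\<And>x. x \<in> space M \<Longrightarrow> cmod (w x) \<le> B"
  shows "integrable M w"
  using assms by (intro integrable_const_bound[where B=B]) auto

text \<open>Because \<^term>\<open>w\<close> has mean zero, \<^term>\<open>1 + w\<close> is a probability density, which makes the
  uniqueness theorem for characteristic functions applicable.\<close>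

lemma (in prob_space) expectation_indicator_eq_0_real:
  fixes w X :: "'a \<Rightarrow> real"
  assumes [measurable]: "w \<in> borel_measurable M" "X \<in> borel_measurable M" "A \<in> sets borel"
    and w: "\<And>x. x \<in> space M \<Longrightarrow> \<bar>w x\<bar> \<le> 1"
    and z: "\<And>t. (CLINT x|M. complex_of_real (w x) * iexp (t * X x)) = 0"
  shows "(LINT x|M. w x * indicator A (X x)) = 0"
proof -
  have iw: "integrable M w"
    using w by (intro integrable_const_bound[where B=1]) auto
  have w0: "(LINT x|M. w x) = 0"
    using z[of 0] by (simp add: integral_complex_of_real)
  have nn: "AE x in M. 0 \<le> 1 + w x"
    by (rule AE_I2) (use w in \<open>force simp: abs_le_iff\<close>)
  define N where "N = density M (\<lambda>x. ennreal (1 + w x))"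
  have eN: "emeasure N (space N) = 1"
  proof -
    have "emeasure N (space N) = (\<integral>\<^sup>+x. ennreal (1 + w x) \<partial>M)"
      by (simp add: N_def emeasure_density cong: nn_integral_cong)
    also have "\<dots> = ennreal (LINT x|M. 1 + w x)"
      using iw nn by (intro nn_integral_eq_integral) auto
    finally show ?thesis using iw w0 by (simp add: prob_space)
  qed
  interpret N: prob_space N using eN by (rule prob_spaceI)
  have XN [measurable]: "X \<in> borel_measurable N" by (simp add: N_def)
  have "distr N borel X = distr M borel X"
  proof (rule Levy_uniqueness)
    show "real_distribution (distr N borel X)" "real_distribution (distr M borel X)"
      by (auto intro!: N.real_distribution_distr real_distribution_distr)
    show "char (distr N borel X) = char (distr M borel X)"
    proof
      fix t
      have i1: "integrable M (\<lambda>x. complex_of_real (w x) * iexp (t * X x))"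
        using w by (intro integrable_bounded_cmod[where B=1]) (auto simp: norm_mult)
      have i2: "integrable M (\<lambda>x. iexp (t * X x))"
        by (intro integrable_bounded_cmod[where B=1]) auto
      have "char (distr N borel X) t = (CLINT x|N. iexp (t * X x))"
        by (simp add: char_def integral_distr)
      also have "\<dots> = (CLINT x|M. (1 + w x) *\<^sub>R iexp (t * X x))"
        unfolding N_def using nn by (intro integral_density) auto
      also have "\<dots> = (CLINT x|M. iexp (t * X x) + complex_of_real (w x) * iexp (t * X x))"
        by (intro Bochner_Integration.integral_cong) (auto simp: scaleR_conv_of_real algebra_simps)
      also have "\<dots> = (CLINT x|M. iexp (t * X x))"
        using i1 i2 z[of t] by simp
      also have "\<dots> = char (distr M borel X) t"
        by (simp add: char_def integral_distr)
      finally show "char (distr N borel X) t = char (distr M borel X) t" .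
    qed
  qed
  then have "(LINT x|distr N borel X. indicator A x) = (LINT x|distr M borel X. indicator A x :: real)"
    by (rule arg_cong)
  then have "(LINT x|N. indicator A (X x)) = (LINT x|M. indicator A (X x) :: real)"
    by (subst (asm) (1 2) integral_distr) auto
  also have "(LINT x|N. indicator A (X x) :: real) = (LINT x|M. (1 + w x) *\<^sub>R indicator A (X x))"
    unfolding N_def using nn by (intro integral_density) auto
  also have "\<dots> = (LINT x|M. indicator A (X x) + w x * indicator A (X x))"
    by (intro Bochner_Integration.integral_cong) (auto simp: algebra_simps)
  also have "\<dots> = (LINT x|M. indicator A (X x)) + (LINT x|M. w x * indicator A (X x))"
    using w by (intro Bochner_Integration.integral_add integrable_const_bound[where B=1])
      (auto simp: indicator_def)
  finally show ?thesis by simp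
qed

text \<open>Conjugation turns the hypothesis at \<open>-t\<close> into the hypothesis at
  \<open>t\<close> for \<open>cnj (w x)\<close>, so it passes to the real and the imaginary part,
  and the real case applies to each. Complex weights arise in the induction over coordinates, where
  exponentials in the other coordinates are absorbed into \<open>w\<close>.\<close>

lemma (in prob_space) expectation_indicator_eq_0_complex:
  fixes w :: "'a \<Rightarrow> complex" and X :: "'a \<Rightarrow> real"
  assumes [measurable]: "w \<in> borel_measurable M" "X \<in> borel_measurable M" "A \<in> sets borel"
    and w: "\<And>x. x \<in> space M \<Longrightarrow> cmod (w x) \<le> 1"
    and z: "\<And>t. (CLINT x|M. w x * iexp (t * X x)) = 0"
  shows "(CLINT x|M. w x * complex_of_real (indicator A (X x))) = 0"
proof -
  have [measurable]: "(\<lambda>x. cnj (w x)) \<in> borel_measurable M"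
    by (intro borel_measurable_continuous_on[where f=cnj] continuous_intros assms)
  have i: "integrable M (\<lambda>x. w x * iexp (t * X x))" for t
    using w by (intro integrable_bounded_cmod[where B=1]) (auto simp: norm_mult)
  have i': "integrable M (\<lambda>x. cnj (w x) * iexp (t * X x))" for t
    using w by (intro integrable_bounded_cmod[where B=1]) (auto simp: norm_mult)
  have z': "(CLINT x|M. cnj (w x) * iexp (t * X x)) = 0" for t
  proof -
    have "(CLINT x|M. cnj (w x) * iexp (t * X x)) = (CLINT x|M. cnj (w x * iexp ((-t) * X x)))"
      by (intro Bochner_Integration.integral_cong) (auto simp: exp_cnj)
    also have "\<dots> = cnj (CLINT x|M. w x * iexp ((-t) * X x))"
      by (rule integral_bounded_linear[OF bounded_linear_cnj i])
    finally show ?thesis using z[of "-t"] by simp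
  qed
  have re: "(CLINT x|M. complex_of_real (Re (w x)) * iexp (t * X x)) = 0" for t
  proof -
    have "(CLINT x|M. complex_of_real (Re (w x)) * iexp (t * X x)) =
       (CLINT x|M. (1/2) * (w x * iexp (t * X x) + cnj (w x) * iexp (t * X x)))"
      by (intro Bochner_Integration.integral_cong) (auto simp: complex_add_cnj distrib_right[symmetric])
    also have "\<dots> = 0"
      using i[of t] i'[of t] z[of t] z'[of t] by simp
    finally show ?thesis .
  qed
  have im: "(CLINT x|M. complex_of_real (Im (w x)) * iexp (t * X x)) = 0" for t
  proof -
    have "(CLINT x|M. complex_of_real (Im (w x)) * iexp (t * X x)) =
       (CLINT x|M. (1/(2*\<i>)) * (w x * iexp (t * X x) - cnj (w x) * iexp (t * X x)))"
    proof (intro Bochner_Integration.integral_cong refl)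
      fix x
      have "complex_of_real (Im (w x)) = (1/(2*\<i>)) * (w x - cnj (w x))"
        by (simp add: complex_eq_iff)
      then show "complex_of_real (Im (w x)) * iexp (t * X x) =
          (1/(2*\<i>)) * (w x * iexp (t * X x) - cnj (w x) * iexp (t * X x))"
        by (simp only: left_diff_distrib mult.assoc)
    qed
    also have "\<dots> = 0"
      using i[of t] i'[of t] z[of t] z'[of t] by simp
    finally show ?thesis .
  qed
  have R: "(LINT x|M. Re (w x) * indicator A (X x)) = 0"
    using w abs_Re_le_cmod order_trans by (intro expectation_indicator_eq_0_real re) (auto, blast)
  have I: "(LINT x|M. Im (w x) * indicator A (X x)) = 0"
    using w abs_Im_le_cmod order_trans by (intro expectation_indicator_eq_0_real im) (auto, blast)
  have ii: "integrable M (\<lambda>x. w x * complex_of_real (indicator A (X x)))"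
    using w by (intro integrable_bounded_cmod[where B=1]) (auto simp: norm_mult indicator_def)
  show ?thesis
    using R I by (intro complex_eqI) (simp_all flip: integral_Re[OF ii] integral_Im[OF ii])
qed

text \<open>A vanishing joint transform is converted one coordinate at a time. With \<open>t\<close>
  fixed on \<open>J\<close>, \<open>w * iexp (\<Sum>j\<in>J. t j * X j x)\<close> is an admissible
  weight for the one-dimensional result in \<open>X k\<close>. This trades the exponential in
  coordinate \<open>k\<close> for an indicator, which then joins the weight; hence the
  generalisation over \<open>w\<close>.\<close>

lemma (in prob_space) expectation_prod_indicator_eq_0:
  fixes w :: "'a \<Rightarrow> complex" and X :: "'i \<Rightarrow> 'a \<Rightarrow> real"
  assumes "finite J"
    and "w \<in> borel_measurable M" "\<And>x. x \<in> space M \<Longrightarrow> cmod (w x) \<le> 1"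
    and "\<And>j. j \<in> J \<Longrightarrow> X j \<in> borel_measurable M" "\<And>j. j \<in> J \<Longrightarrow> A j \<in> sets borel"
    and "\<And>t. (CLINT x|M. w x * iexp (\<Sum>j\<in>J. t j * X j x)) = 0"
  shows "(CLINT x|M. w x * (\<Prod>j\<in>J. complex_of_real (indicator (A j) (X j x)))) = 0"
  using assms
proof (induction J arbitrary: w rule: finite_induct)
  case empty
  from empty.prems(5)[of undefined] show ?case by simp
next
  case (insert k J)
  note [measurable] = insert.prems(1)
  have [measurable]: "X k \<in> borel_measurable M" "A k \<in> sets borel"
    and XJ [measurable]: "\<And>j. j \<in> J \<Longrightarrow> X j \<in> borel_measurable M"
    using insert.prems by auto
  have "(CLINT x|M. (w x * complex_of_real (indicator (A k) (X k x))) * iexp (\<Sum>j\<in>J. t j * X j x)) = 0" for t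
  proof -
    have "(CLINT x|M. (w x * iexp (\<Sum>j\<in>J. t j * X j x)) * complex_of_real (indicator (A k) (X k x))) = 0"
    proof (rule expectation_indicator_eq_0_complex)
      fix s
      have "(CLINT x|M. w x * iexp (\<Sum>j\<in>J. t j * X j x) * iexp (s * X k x)) =
        (CLINT x|M. w x * iexp (\<Sum>j\<in>insert k J. (t(k := s)) j * X j x))"
      proof (intro Bochner_Integration.integral_cong refl)
        fix x
        have "(\<Sum>j\<in>insert k J. (t(k := s)) j * X j x) = s * X k x + (\<Sum>j\<in>J. t j * X j x)"
          using insert.hyps by (auto intro!: arg_cong2[where f="(+)"] sum.cong)
        then show "w x * iexp (\<Sum>j\<in>J. t j * X j x) * iexp (s * X k x) =
            w x * iexp (\<Sum>j\<in>insert k J. (t(k := s)) j * X j x)"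
          by (simp add: exp_add distrib_left)
      qed
      then show "(CLINT x|M. w x * iexp (\<Sum>j\<in>J. t j * X j x) * iexp (s * X k x)) = 0"
        using insert.prems(5)[of "t(k := s)"] by simp
    qed (use insert.prems(2) in \<open>auto simp: norm_mult\<close>)
    then show ?thesis by (simp add: mult_ac)
  qed
  then have "(CLINT x|M. (w x * complex_of_real (indicator (A k) (X k x))) * (\<Prod>j\<in>J. complex_of_real (indicator (A j) (X j x)))) = 0"
    by (intro insert.IH) (use insert.prems in \<open>auto simp: norm_mult indicator_def\<close>)
  then show ?case using insert.hyps by (simp add: mult_ac)
qed

text \<open>As in the scalar case, \<open>1 + w\<close> is a probability density. Boxes generate the
  product sigma-algebra and are stable under intersection, so the joint law of the
  \<open>X j\<close> is the same under \<open>M\<close> and \<open>N\<close>. Comparing the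
  integrals of \<open>h\<close> under the two laws isolates the term with \<open>w\<close>, for any
  integrable \<open>h\<close>, however nonlinear.\<close>

lemma (in prob_space) expectation_mult_eq_0_of_char:
  fixes w :: "'a \<Rightarrow> real" and X :: "nat \<Rightarrow> 'a \<Rightarrow> real" and h :: "(nat \<Rightarrow> real) \<Rightarrow> real"
  assumes [measurable]: "w \<in> borel_measurable M"
    and w: "\<And>x. x \<in> space M \<Longrightarrow> \<bar>w x\<bar> \<le> 1"
    and X [measurable]: "\<And>j. j < m \<Longrightarrow> X j \<in> borel_measurable M"
    and z: "\<And>t. (CLINT x|M. complex_of_real (w x) * iexp (\<Sum>j<m. t j * X j x)) = 0"
    and h [measurable]: "h \<in> borel_measurable (Pi\<^sub>M {..<m} (\<lambda>_. borel))"
    and ih: "integrable M (\<lambda>x. h (\<lambda>j\<in>{..<m}. X j x))"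
  shows "(LINT x|M. w x * h (\<lambda>j\<in>{..<m}. X j x)) = 0"
proof -
  let ?P = "Pi\<^sub>M {..<m} (\<lambda>_. borel :: real measure)"
  let ?X = "\<lambda>x. \<lambda>j\<in>{..<m}. X j x"
  have Xm [measurable]: "?X \<in> measurable M ?P"
    by (rule measurable_restrict) auto
  have iw: "integrable M w"
    using w by (intro integrable_const_bound[where B=1]) auto
  have w0: "(LINT x|M. w x) = 0"
    using z[of "\<lambda>_. 0"] by (simp add: integral_complex_of_real)
  have nn: "AE x in M. 0 \<le> 1 + w x"
    by (rule AE_I2) (use w in \<open>force simp: abs_le_iff\<close>)
  define N where "N = density M (\<lambda>x. ennreal (1 + w x))"
  have sN [simp, measurable_cong]: "sets N = sets M" by (simp add: N_def)
  have eN: "emeasure N (space N) = 1"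
  proof -
    have "emeasure N (space N) = (\<integral>\<^sup>+x. ennreal (1 + w x) \<partial>M)"
      by (simp add: N_def emeasure_density cong: nn_integral_cong)
    also have "\<dots> = ennreal (LINT x|M. 1 + w x)"
      using iw nn by (intro nn_integral_eq_integral) auto
    finally show ?thesis using iw w0 by (simp add: prob_space)
  qed
  interpret N: prob_space N using eN by (rule prob_spaceI)
  have box: "emeasure (distr N ?P ?X) (Pi\<^sub>E {..<m} A) = emeasure (distr M ?P ?X) (Pi\<^sub>E {..<m} A)"
    if A: "\<And>i. i \<in> {..<m} \<Longrightarrow> A i \<in> sets borel" for A
  proof -
    let ?B = "Pi\<^sub>E {..<m} A"
    have B [measurable]: "?B \<in> sets ?P" using A by (intro sets_PiM_I_finite) auto
    have ind: "(\<Prod>j<m. indicator (A j) (X j x)) = (indicator ?B (?X x) :: real)" for x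
      by (auto simp: indicator_def PiE_iff extensional_def)
    have "(CLINT x|M. complex_of_real (w x) * (\<Prod>j<m. complex_of_real (indicator (A j) (X j x)))) = 0"
      using w z A by (intro expectation_prod_indicator_eq_0) auto
    then have "(CLINT x|M. complex_of_real (w x * indicator ?B (?X x))) = 0"
      by (simp flip: ind)
    then have wB: "(LINT x|M. w x * indicator ?B (?X x)) = 0"
      by (simp only: integral_complex_of_real of_real_eq_0_iff)
    have B': "?B \<inter> space ?P = ?B"
      using sets.sets_into_space[OF B] by blast
    have "measure (distr N ?P ?X) ?B = (LINT x|distr N ?P ?X. indicator ?B x)"
      using B' by simp
    also have "\<dots> = (LINT x|N. indicator ?B (?X x))"
      by (subst integral_distr) auto
    also have "\<dots> = (LINT x|M. (1 + w x) *\<^sub>R indicator ?B (?X x))"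
      unfolding N_def using nn by (intro integral_density) auto
    also have "\<dots> = (LINT x|M. indicator ?B (?X x) + w x * indicator ?B (?X x))"
      by (intro Bochner_Integration.integral_cong) (auto simp: algebra_simps)
    also have "\<dots> = (LINT x|M. indicator ?B (?X x)) + (LINT x|M. w x * indicator ?B (?X x))"
    proof (intro Bochner_Integration.integral_add integrable_const_bound[where B=1] AE_I2)
      show "norm (indicator ?B (?X x) :: real) \<le> 1" for x
        by (simp split: split_indicator)
      show "norm (w x * indicator ?B (?X x) :: real) \<le> 1" if "x \<in> space M" for x
        using w[OF that] by (simp split: split_indicator)
    qed measurable
    also have "\<dots> = (LINT x|distr M ?P ?X. indicator ?B x)"
      using wB by (subst integral_distr) auto
    also have "\<dots> = measure (distr M ?P ?X) ?B"
      using B' by simp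
    finally have eq: "measure (distr N ?P ?X) ?B = measure (distr M ?P ?X) ?B" .
    interpret D1: prob_space "distr N ?P ?X" by (rule N.prob_space_distr) auto
    interpret D2: prob_space "distr M ?P ?X" by (rule prob_space_distr) auto
    show ?thesis using eq by (simp add: D1.emeasure_eq_measure D2.emeasure_eq_measure)
  qed
  interpret D: prob_space "distr N ?P ?X" by (rule N.prob_space_distr) auto
  have "distr N ?P ?X = distr M ?P ?X"
  proof (rule measure_eqI_PiM_finite[where A="\<lambda>_. Pi\<^sub>E {..<m} (\<lambda>_. UNIV)" and I="{..<m}"])
    show "emeasure (distr N ?P ?X) (Pi\<^sub>E {..<m} (\<lambda>_. UNIV)) \<noteq> \<infinity>" for i :: nat
      by simp
    show "range (\<lambda>_::nat. Pi\<^sub>E {..<m} (\<lambda>_. UNIV)) \<subseteq> prod_algebra {..<m} (\<lambda>_. borel :: real measure)"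
      by (auto intro!: prod_algebraI_finite)
  qed (use box in \<open>auto simp: space_PiM\<close>)
  then have "(LINT y|distr N ?P ?X. h y) = (LINT y|distr M ?P ?X. h y)" by simp
  then have "(LINT x|N. h (?X x)) = (LINT x|M. h (?X x))"
    by (subst (asm) (1 2) integral_distr) measurable
  also have "(LINT x|N. h (?X x)) = (LINT x|M. (1 + w x) *\<^sub>R h (?X x))"
    unfolding N_def using nn by (intro integral_density) auto
  also have "\<dots> = (LINT x|M. h (?X x) + w x * h (?X x))"
    by (intro Bochner_Integration.integral_cong) (auto simp: algebra_simps)
  also have "\<dots> = (LINT x|M. h (?X x)) + (LINT x|M. w x * h (?X x))"
  proof (intro Bochner_Integration.integral_add ih Bochner_Integration.integrable_bound[OF ih])
    show "AE x in M. norm (w x * h (?X x)) \<le> norm (h (?X x))"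
      using w by (intro AE_I2) (auto simp: abs_mult intro!: mult_left_le_one_le)
  qed auto
  finally show ?thesis by linarith
qed

subsection \<open>Square-integrable functions\<close>

lemma integrable_mult_of_squares:
  fixes f g :: "'a \<Rightarrow> real"
  assumes [measurable]: "f \<in> borel_measurable M" "g \<in> borel_measurable M"
    and "integrable M (\<lambda>x. (f x)\<^sup>2)" "integrable M (\<lambda>x. (g x)\<^sup>2)"
  shows "integrable M (\<lambda>x. f x * g x)"
proof (rule Bochner_Integration.integrable_bound)
  show "integrable M (\<lambda>x. (f x)\<^sup>2 + (g x)\<^sup>2)" using assms by simp
  have "\<bar>a * b\<bar> \<le> a\<^sup>2 + b\<^sup>2" for a b :: real
  proof -
    have "2 * (\<bar>a\<bar> * \<bar>b\<bar>) \<le> a\<^sup>2 + b\<^sup>2"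
      using sum_squares_bound[of "\<bar>a\<bar>" "\<bar>b\<bar>"] by (simp add: mult.assoc)
    moreover have "0 \<le> \<bar>a\<bar> * \<bar>b\<bar>" by simp
    ultimately show ?thesis unfolding abs_mult by linarith
  qed
  then show "AE x in M. norm (f x * g x) \<le> norm ((f x)\<^sup>2 + (g x)\<^sup>2)"
    by simp
qed simp

lemma integrable_power2_add:
  fixes f g :: "'a \<Rightarrow> real"
  assumes "f \<in> borel_measurable M" "g \<in> borel_measurable M"
    and "integrable M (\<lambda>x. (f x)\<^sup>2)" "integrable M (\<lambda>x. (g x)\<^sup>2)"
  shows "integrable M (\<lambda>x. (f x + g x)\<^sup>2)"
  using assms integrable_mult_of_squares[OF assms] by (simp add: power2_sum mult.assoc)

lemma integrable_power2_sum:
  fixes f :: "'i \<Rightarrow> 'a \<Rightarrow> real"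
  assumes "\<And>i. i \<in> I \<Longrightarrow> f i \<in> borel_measurable M" "\<And>i. i \<in> I \<Longrightarrow> integrable M (\<lambda>x. (f i x)\<^sup>2)"
  shows "integrable M (\<lambda>x. (\<Sum>i\<in>I. f i x)\<^sup>2)"
  using assms
proof (induction I rule: infinite_finite_induct)
  case (insert i I)
  then show ?case
    by (simp add: integrable_power2_add borel_measurable_sum)
qed auto

text \<open>Stated for a class \<open>S\<close> closed under linear operations because it serves
  twice: for functionals in \<open>L_2(\<mu>)\<close> and for functions in \<open>L_2(w)\<close>.
  Vectors depending on earlier ones modulo null sets are dropped, so \<open>m\<close> may be smaller
  than \<open>n\<close>, and the expansions hold almost everywhere only.\<close>

lemma gram_schmidt_L2:
  fixes S :: "('a \<Rightarrow> real) set" and v :: "nat \<Rightarrow> 'a \<Rightarrow> real"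
  assumes meas: "\<And>f. f \<in> S \<Longrightarrow> f \<in> borel_measurable M"
    and sq: "\<And>f. f \<in> S \<Longrightarrow> integrable M (\<lambda>x. (f x)\<^sup>2)"
    and add: "\<And>f g. f \<in> S \<Longrightarrow> g \<in> S \<Longrightarrow> (\<lambda>x. f x + g x) \<in> S"
    and scale: "\<And>f c. f \<in> S \<Longrightarrow> (\<lambda>x. c * f x) \<in> S"
    and v: "\<And>i. i < n \<Longrightarrow> v i \<in> S"
  shows "\<exists>m\<le>n. \<exists>e a. (\<forall>j<m. e j \<in> S) \<and>
     (\<forall>j<m. \<forall>k<m. (LINT x|M. e j x * e k x) = (if j = k then 1 else 0)) \<and>
     (\<forall>i<n. AE x in M. v i x = (\<Sum>j<m. a i j * e j x))"
  using v
proof (induction n)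
  case 0
  then show ?case by auto
next
  case (Suc n)
  have mult: "integrable M (\<lambda>x. f x * g x)" if "f \<in> S" "g \<in> S" for f g
    using that by (intro integrable_mult_of_squares meas sq)
  from Suc.IH[OF Suc.prems[OF less_SucI]] obtain m e a where m: "m \<le> n"
    and eoa: "(\<forall>j<m. e j \<in> S) \<and>
     (\<forall>j<m. \<forall>k<m. (LINT x|M. e j x * e k x) = (if j = k then 1 else 0)) \<and>
     (\<forall>i<n. AE x in M. v i x = (\<Sum>j<m. a i j * e j x))"
    by blast
  from eoa have e: "\<And>j. j < m \<Longrightarrow> e j \<in> S"
    and orth: "\<And>j k. j < m \<Longrightarrow> k < m \<Longrightarrow> (LINT x|M. e j x * e k x) = (if j = k then 1 else 0)"
    and rep: "\<And>i. i < n \<Longrightarrow> AE x in M. v i x = (\<Sum>j<m. a i j * e j x)"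
    by auto
  define c where "c j = (LINT x|M. v n x * e j x)" for j
  define r where "r x = v n x - (\<Sum>j<m. c j * e j x)" for x
  have vn: "v n \<in> S" using Suc.prems by simp
  have part: "(\<lambda>x. v n x + (\<Sum>j<k. - c j * e j x)) \<in> S" if "k \<le> m" for k
    using that
  proof (induction k)
    case (Suc k)
    have h: "(\<lambda>x. v n x + (\<Sum>j<k. - c j * e j x)) \<in> S"
      using Suc by auto
    have "(\<lambda>x. - c k * e k x) \<in> S"
      using Suc by (intro scale e) simp
    from add[OF h this] show ?case by (simp add: add_diff_eq)
  qed (use vn in simp)
  from part[OF order_refl] have "(\<lambda>x. v n x + (\<Sum>j<m. - c j * e j x)) \<in> S"
    .
  moreover have "r = (\<lambda>x. v n x + (\<Sum>j<m. - c j * e j x))"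
    by (auto simp: r_def sum_negf)
  ultimately have rS: "r \<in> S"
    by (simp only:)
  have r_orth: "(LINT x|M. r x * e k x) = 0" if "k < m" for k
  proof -
    have "(LINT x|M. r x * e k x) = (LINT x|M. v n x * e k x - (\<Sum>j<m. c j * (e j x * e k x)))"
      by (simp add: r_def left_diff_distrib sum_distrib_right mult.assoc)
    also have "\<dots> = c k - (\<Sum>j<m. c j * (LINT x|M. e j x * e k x))"
      using that vn by (subst Bochner_Integration.integral_diff) (auto simp: c_def mult e)
    also have "\<dots> = 0"
      using that by (simp add: orth if_distrib cong: if_cong)
    finally show ?thesis .
  qed
  show ?case
  proof (cases "(LINT x|M. (r x)\<^sup>2) = 0")
    case True
    then have "AE x in M. (r x)\<^sup>2 = 0"
      using sq[OF rS] by (subst (asm) integral_nonneg_eq_0_iff_AE) auto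
    then have "AE x in M. v n x = (\<Sum>j<m. c j * e j x)"
      by eventually_elim (simp add: r_def)
    then have "\<forall>i<Suc n. AE x in M. v i x = (\<Sum>j<m. (a(n := c)) i j * e j x)"
      using rep by (auto simp: less_Suc_eq)
    then show ?thesis
      using m e orth by (intro exI[of _ m] conjI exI[of _ e] exI[of _ "a(n := c)"]) auto
  next
    case False
    define R where "R = (LINT x|M. (r x)\<^sup>2)"
    have R: "R > 0" using False by (simp add: R_def order_less_le)
    define q where "q x = (1 / sqrt R) * r x" for x
    have qS: "q \<in> S" unfolding q_def[abs_def] by (intro scale rS)
    have qq: "(LINT x|M. q x * q x) = 1"
    proof -
      have "(LINT x|M. q x * q x) = (LINT x|M. (r x)\<^sup>2 / R)"
        using R by (intro Bochner_Integration.integral_cong) (auto simp: q_def power2_eq_square)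
      then show ?thesis using R by (simp add: R_def[symmetric])
    qed
    have qe: "(LINT x|M. q x * e k x) = 0" if "k < m" for k
      using r_orth[OF that] by (simp add: q_def mult.assoc)
    have eq: "(LINT x|M. e k x * q x) = 0" if "k < m" for k
      using qe[OF that] by (simp add: mult.commute)
    define e' where "e' = e(m := q)"
    \<comment> \<open>The new vector \<open>q\<close> has index \<open>m\<close>: earlier
      \<open>v i\<close> get coefficient 0 there, and \<open>v n\<close> gets the norm
      \<open>sqrt R\<close> of its residual, since \<open>r = sqrt R * q\<close>.\<close>
    define a' where "a' i j = (if i < n then (if j < m then a i j else 0) else (if j < m then c j else sqrt R))" for i j
    have "\<forall>j<Suc m. e' j \<in> S" using e qS by (auto simp: e'_def less_Suc_eq)
    moreover have "\<forall>j<Suc m. \<forall>k<Suc m. (LINT x|M. e' j x * e' k x) = (if j = k then 1 else 0)"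
      using orth qq qe eq by (auto simp: e'_def less_Suc_eq)
    moreover have "\<forall>i<Suc n. AE x in M. v i x = (\<Sum>j<Suc m. a' i j * e' j x)"
    proof (intro allI impI)
      fix i assume "i < Suc n"
      then consider "i < n" | "i = n" by linarith
      then show "AE x in M. v i x = (\<Sum>j<Suc m. a' i j * e' j x)"
      proof cases
        case 1
        then show ?thesis using rep[OF 1] by (simp add: a'_def e'_def)
      next
        case 2
        then show ?thesis using R by (simp add: a'_def e'_def q_def r_def)
      qed
    qed
    moreover have "Suc m \<le> Suc n" using m by simp
    ultimately show ?thesis
      by - (rule exI[of _ "Suc m"], intro conjI exI[of _ e'] exI[of _ a'], assumption+)
  qed
qed

subsection \<open>Sample points by averaging\<close>

lemma (in prob_space) exists_le_expectation:
  assumes "integrable M p" "AE x in M. Q x"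
  shows "\<exists>x\<in>space M. Q x \<and> p x \<le> (LINT x|M. p x :: real)"
proof (rule ccontr)
  assume "\<not> ?thesis"
  then have "AE x in M. (LINT x|M. p x) < p x"
    using assms(2) AE_space[of M] by (auto elim!: eventually_elim2 simp: not_le)
  then have "(LINT x|M. (LINT x|M. p x)) < (LINT x|M. p x)"
    using assms(1) emeasure_space_1 by (intro integral_less_AE_space) auto
  then show False by (simp add: prob_space)
qed

text \<open>Greedy choice: a new point adds, on average over \<^term>\<open>\<kappa>\<close>, no cross terms because
  \<^term>\<open>H i f\<close> has mean zero.\<close>

lemma exists_sample_points:
  fixes H :: "'i \<Rightarrow> 'a \<Rightarrow> 'b \<Rightarrow> real"
  assumes "prob_space \<mu>" "prob_space \<kappa>" "finite I"
    and H [measurable]: "\<And>i. i \<in> I \<Longrightarrow> (\<lambda>(f, x). H i f x) \<in> borel_measurable (\<mu> \<Otimes>\<^sub>M \<kappa>)"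
    and sq: "\<And>i. i \<in> I \<Longrightarrow> integrable (\<mu> \<Otimes>\<^sub>M \<kappa>) (\<lambda>(f, x). (H i f x)\<^sup>2)"
    and mean: "\<And>i. i \<in> I \<Longrightarrow> AE f in \<mu>. (LINT x|\<kappa>. H i f x) = 0"
    and C: "(\<Sum>i\<in>I. LINT (f, x)|(\<mu> \<Otimes>\<^sub>M \<kappa>). (H i f x)\<^sup>2) \<le> C"
    and Q: "AE x in \<kappa>. Q x"
  shows "\<exists>x. (\<forall>k<N. x k \<in> space \<kappa> \<and> Q (x k)) \<and>
     (\<forall>k<N. \<forall>i\<in>I. integrable \<mu> (\<lambda>f. (H i f (x k))\<^sup>2)) \<and>
     (\<Sum>i\<in>I. LINT f|\<mu>. (\<Sum>k<N. H i f (x k))\<^sup>2) \<le> real N * C"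
proof (induction N)
  case 0
  then show ?case by simp
next
  case (Suc N)
  interpret m: prob_space \<mu> by fact
  interpret k: prob_space \<kappa> by fact
  interpret pair_prob_space \<mu> \<kappa> ..
  from Suc obtain x where x: "\<And>k. k < N \<Longrightarrow> x k \<in> space \<kappa>" "\<And>k. k < N \<Longrightarrow> Q (x k)"
    and xi: "\<And>k i. k < N \<Longrightarrow> i \<in> I \<Longrightarrow> integrable \<mu> (\<lambda>f. (H i f (x k))\<^sup>2)"
    and xC: "(\<Sum>i\<in>I. LINT f|\<mu>. (\<Sum>k<N. H i f (x k))\<^sup>2) \<le> real N * C"
    by blast
  define S where "S i f = (\<Sum>k<N. H i f (x k))" for i f
  have Hx: "(\<lambda>f. H i f y) \<in> borel_measurable \<mu>" if "i \<in> I" "y \<in> space \<kappa>" for i y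
    using measurable_compose[OF measurable_Pair2'[OF that(2)] H[OF that(1)]] by simp
  have S [measurable]: "S i \<in> borel_measurable \<mu>" if "i \<in> I" for i
    unfolding S_def[abs_def] using that x by (intro borel_measurable_sum Hx) auto
  have Ssq: "integrable \<mu> (\<lambda>f. (S i f)\<^sup>2)" if "i \<in> I" for i
    unfolding S_def using that x xi by (intro integrable_power2_sum Hx) auto
  have S2: "integrable (\<mu> \<Otimes>\<^sub>M \<kappa>) (\<lambda>(f, y). (S i f)\<^sup>2)" if "i \<in> I" for i
  proof (rule Fubini_integrable)
    show "(\<lambda>(f, y). (S i f)\<^sup>2) \<in> borel_measurable (\<mu> \<Otimes>\<^sub>M \<kappa>)"
      using that by measurable
  qed (use Ssq[OF that] k.prob_space in simp_all)
  have SH: "integrable (\<mu> \<Otimes>\<^sub>M \<kappa>) (\<lambda>(f, y). S i f * H i f y)" if "i \<in> I" for i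
    using integrable_mult_of_squares[of "\<lambda>(f, y). S i f" "\<mu> \<Otimes>\<^sub>M \<kappa>" "\<lambda>(f, y). H i f y"]
      that S2[OF that] sq[OF that] by (simp add: split_beta')
  have SHi: "(LINT (f, y)|(\<mu> \<Otimes>\<^sub>M \<kappa>). S i f * H i f y) = 0" if "i \<in> I" for i
  proof -
    have "(LINT (f, y)|(\<mu> \<Otimes>\<^sub>M \<kappa>). S i f * H i f y) = (LINT f|\<mu>. LINT y|\<kappa>. S i f * H i f y)"
      using integral_fst[OF SH[OF that]] by simp
    also have "\<dots> = (LINT f|\<mu>. S i f * (LINT y|\<kappa>. H i f y))"
      by simp
    also have "\<dots> = (LINT f|\<mu>. 0)"
    proof (rule integral_cong_AE)
      show "AE f in \<mu>. S i f * (LINT y|\<kappa>. H i f y) = 0"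
        using mean[OF that] by eventually_elim simp
      show "(\<lambda>f. S i f * (LINT y|\<kappa>. H i f y)) \<in> borel_measurable \<mu>"
        using that by measurable
    qed simp
    finally show ?thesis by simp
  qed
  have S2i: "(LINT (f, y)|(\<mu> \<Otimes>\<^sub>M \<kappa>). (S i f)\<^sup>2) = (LINT f|\<mu>. (S i f)\<^sup>2)" if "i \<in> I" for i
    using integral_fst[OF S2[OF that]] k.prob_space by simp
  have eq: "(S i f + H i f y)\<^sup>2 = (S i f)\<^sup>2 + 2 * (S i f * H i f y) + (H i f y)\<^sup>2" for i f y
    by (simp add: power2_sum mult_ac)
  have P2: "integrable (\<mu> \<Otimes>\<^sub>M \<kappa>) (\<lambda>(f, y). (S i f + H i f y)\<^sup>2)" if "i \<in> I" for i
    using S2[OF that] SH[OF that] sq[OF that] unfolding eq by (simp add: split_beta')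
  have P2i: "(LINT (f, y)|(\<mu> \<Otimes>\<^sub>M \<kappa>). (S i f + H i f y)\<^sup>2) =
     (LINT f|\<mu>. (S i f)\<^sup>2) + (LINT (f, y)|(\<mu> \<Otimes>\<^sub>M \<kappa>). (H i f y)\<^sup>2)" if "i \<in> I" for i
    using S2[OF that] SH[OF that] sq[OF that] SHi[OF that] S2i[OF that] unfolding eq by (simp add: split_beta')
  define p where "p y = (\<Sum>i\<in>I. LINT f|\<mu>. (S i f + H i f y)\<^sup>2)" for y
  have pi: "integrable \<kappa> p"
    unfolding p_def[abs_def] using integrable_snd[OF P2] by (intro Bochner_Integration.integrable_sum) auto
  have "(LINT y|\<kappa>. p y) = (\<Sum>i\<in>I. LINT y|\<kappa>. LINT f|\<mu>. (S i f + H i f y)\<^sup>2)"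
    unfolding p_def[abs_def] using integrable_snd[OF P2] by (intro Bochner_Integration.integral_sum) auto
  also have "\<dots> = (\<Sum>i\<in>I. (LINT f|\<mu>. (S i f)\<^sup>2) + (LINT (f, y)|(\<mu> \<Otimes>\<^sub>M \<kappa>). (H i f y)\<^sup>2))"
    using integral_snd[OF P2] P2i by (intro sum.cong) auto
  also have "\<dots> \<le> real (Suc N) * C"
    using xC C by (simp add: sum.distrib S_def algebra_simps)
  finally have pC: "(LINT y|\<kappa>. p y) \<le> real (Suc N) * C" .
  \<comment> \<open>The Bochner integral of a non-integrable square would be 0, so a bound on
    \<open>p y\<close> alone says nothing. Integrability at the chosen point is demanded along with
    \<open>Q\<close>; by Fubini it holds for almost every \<open>y\<close>.\<close>
  have "AE y in \<kappa>. Q y \<and> (\<forall>i\<in>I. integrable \<mu> (\<lambda>f. (H i f y)\<^sup>2))"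
    using Q AE_integrable_snd[OF sq] \<open>finite I\<close> by (auto simp: AE_finite_all)
  from k.exists_le_expectation[OF pi this] obtain y where y: "y \<in> space \<kappa>" "Q y"
    "\<And>i. i \<in> I \<Longrightarrow> integrable \<mu> (\<lambda>f. (H i f y)\<^sup>2)" and py: "p y \<le> (LINT y|\<kappa>. p y)"
    by blast
  define x' where "x' = x(N := y)"
  have x'_simps: "x' N = y" "\<And>k. k < N \<Longrightarrow> x' k = x k"
    by (auto simp: x'_def)
  have "(\<Sum>k<Suc N. H i f (x' k)) = S i f + H i f y" for i f
    by (simp add: S_def x'_simps)
  then have "(\<Sum>i\<in>I. LINT f|\<mu>. (\<Sum>k<Suc N. H i f (x' k))\<^sup>2) \<le> real (Suc N) * C"
    using py pC by (simp only: p_def)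
  moreover have "\<forall>k<Suc N. x' k \<in> space \<kappa> \<and> Q (x' k)"
    using x y by (auto simp: less_Suc_eq x'_simps)
  moreover have "\<forall>k<Suc N. \<forall>i\<in>I. integrable \<mu> (\<lambda>f. (H i f (x' k))\<^sup>2)"
    using xi y by (auto simp: less_Suc_eq x'_simps)
  ultimately show ?case by blast
qed

subsection \<open>Matrices near the identity\<close>

text \<open>The Frobenius norm dominates the operator norm, so \<open>c = G c - (G - I) c\<close>
  gives \<open>|c|^2 \<le> 2 |G c|^2 + |c|^2 / 2\<close>, that is
  \<open>|c|^2 \<le> 4 |G c|^2\<close>. This makes \<open>G\<close> injective, hence invertible;
  applied to \<open>c = H b\<close> it is the bound on the inverse.\<close>

lemma left_inverse_near_identity:
  fixes G :: "nat \<Rightarrow> nat \<Rightarrow> real"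
  assumes G: "(\<Sum>i<m. \<Sum>j<m. (G i j - (if i = j then 1 else 0))\<^sup>2) \<le> 1/4"
  shows "\<exists>H. (\<forall>i<m. \<forall>j<m. (\<Sum>k<m. H i k * G k j) = (if i = j then 1 else 0)) \<and>
     (\<forall>b. (\<Sum>i<m. (\<Sum>k<m. H i k * b k)\<^sup>2) \<le> 4 * (\<Sum>k<m. (b k)\<^sup>2))"
proof -
  have bound: "(\<Sum>i<m. (c i)\<^sup>2) \<le> 4 * (\<Sum>i<m. (\<Sum>j<m. G i j * c j)\<^sup>2)" for c :: "nat \<Rightarrow> real"
  proof -
    let ?d = "\<lambda>i j. (if i = j then 1 else 0) :: real"
    have "(\<Sum>i<m. (\<Sum>j<m. (G i j - ?d i j) * c j)\<^sup>2)
       \<le> (\<Sum>i<m. (\<Sum>j<m. (G i j - ?d i j)\<^sup>2) * (\<Sum>j<m. (c j)\<^sup>2))"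
      by (intro sum_mono Cauchy_Schwarz_ineq_sum)
    also have "\<dots> = (\<Sum>i<m. \<Sum>j<m. (G i j - ?d i j)\<^sup>2) * (\<Sum>j<m. (c j)\<^sup>2)"
      by (simp add: sum_distrib_right)
    also have "\<dots> \<le> 1/4 * (\<Sum>j<m. (c j)\<^sup>2)"
      by (intro mult_right_mono G sum_nonneg) auto
    finally have 1: "(\<Sum>i<m. (\<Sum>j<m. (G i j - ?d i j) * c j)\<^sup>2) \<le> 1/4 * (\<Sum>j<m. (c j)\<^sup>2)" .
    have "(\<Sum>i<m. (c i)\<^sup>2) \<le> (\<Sum>i<m. 2 * (\<Sum>j<m. G i j * c j)\<^sup>2 + 2 * (\<Sum>j<m. (G i j - ?d i j) * c j)\<^sup>2)"
    proof (rule sum_mono)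
      fix i assume i: "i \<in> {..<m}"
      let ?a = "\<Sum>j<m. G i j * c j" and ?b = "\<Sum>j<m. (G i j - ?d i j) * c j"
      have "c i = ?a - ?b"
        using i by (simp add: left_diff_distrib sum_subtractf if_distrib[of "\<lambda>x. x * _"] cong: if_cong)
      moreover have "(a - b)\<^sup>2 \<le> 2 * a\<^sup>2 + 2 * b\<^sup>2" for a b :: real
        using zero_le_power2[of "a + b"] by (simp add: power2_sum power2_diff)
      ultimately show "(c i)\<^sup>2 \<le> 2 * ?a\<^sup>2 + 2 * ?b\<^sup>2" by metis
    qed
    also have "\<dots> \<le> 2 * (\<Sum>i<m. (\<Sum>j<m. G i j * c j)\<^sup>2) + 2 * (1/4 * (\<Sum>j<m. (c j)\<^sup>2))"
      using 1 by (simp add: sum.distrib sum_distrib_left[symmetric])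
    finally show ?thesis by simp
  qed
  define A where "A = mat m m (\<lambda>(i, j). G i j)"
  have A: "A \<in> carrier_mat m m" by (simp add: A_def)
  have "det A \<noteq> 0"
  proof
    assume "det A = 0"
    then obtain v where v: "v \<in> carrier_vec m" "v \<noteq> 0\<^sub>v m" "A *\<^sub>v v = 0\<^sub>v m"
      using det_0_iff_vec_prod_zero_field[OF A] by auto
    have "(\<Sum>j<m. G i j * vec_index v j) = 0" if "i < m" for i
    proof -
      have "(\<Sum>j<m. G i j * vec_index v j) = vec_index (A *\<^sub>v v) i"
        using that v(1) by (simp add: A_def scalar_prod_def lessThan_atLeast0)
      then show ?thesis using v(3) that by simp
    qed
    then have "(\<Sum>i<m. (vec_index v i)\<^sup>2) \<le> 0"
      using bound[of "\<lambda>i. vec_index v i"] by simp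
    then have "(\<Sum>i<m. (vec_index v i)\<^sup>2) = 0"
      by (intro antisym sum_nonneg) auto
    then have "\<forall>i<m. vec_index v i = 0"
      by (subst (asm) sum_nonneg_eq_0_iff) auto
    then have "v = 0\<^sub>v m" using v(1) by auto
    with v(2) show False by simp
  qed
  from det_non_zero_imp_unit[OF A this, of "()"] obtain B
    where B: "B \<in> carrier_mat m m" "B * A = 1\<^sub>m m" "A * B = 1\<^sub>m m"
    by (auto simp: Units_def ring_mat_def)
  have BA: "(\<Sum>k<m. B $$ (i, k) * G k j) = (if i = j then 1 else 0)" if "i < m" "j < m" for i j
  proof -
    have "(\<Sum>k<m. B $$ (i, k) * G k j) = (B * A) $$ (i, j)"
      using that B(1) by (simp add: A_def scalar_prod_def lessThan_atLeast0)
    then show ?thesis using B(2) that by simp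
  qed
  have AB: "(\<Sum>k<m. G i k * B $$ (k, j)) = (if i = j then 1 else 0)" if "i < m" "j < m" for i j
  proof -
    have "(\<Sum>k<m. G i k * B $$ (k, j)) = (A * B) $$ (i, j)"
      using that B(1) by (simp add: A_def scalar_prod_def lessThan_atLeast0)
    then show ?thesis using B(3) that by simp
  qed
  have "(\<Sum>i<m. (\<Sum>k<m. B $$ (i, k) * b k)\<^sup>2) \<le> 4 * (\<Sum>k<m. (b k)\<^sup>2)" for b
  proof -
    have "(\<Sum>j<m. G i j * (\<Sum>k<m. B $$ (j, k) * b k)) = b i" if "i < m" for i
    proof -
      have "(\<Sum>j<m. G i j * (\<Sum>k<m. B $$ (j, k) * b k)) = (\<Sum>k<m. (\<Sum>j<m. G i j * B $$ (j, k)) * b k)"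
        by (simp add: sum_distrib_left sum_distrib_right mult.assoc) (rule sum.swap)
      then show ?thesis
        using that by (simp add: AB if_distrib[of "\<lambda>x. x * _"] cong: if_cong)
    qed
    then show ?thesis using bound[of "\<lambda>i. \<Sum>k<m. B $$ (i, k) * b k"] by simp
  qed
  then show ?thesis using BA by (intro exI[of _ "\<lambda>i k. B $$ (i, k)"]) auto
qed

subsection \<open>Orthonormal expansions\<close>

text \<open>The coefficients \<open>t\<close> are left free: Fourier coefficients yield Bessel's
  inequality, \<open>f = 0\<close> yields Parseval's identity, and comparing two choices yields best
  approximation.\<close>

lemma orthonormal_expansion:
  fixes f :: "'a \<Rightarrow> real" and e :: "nat \<Rightarrow> 'a \<Rightarrow> real"
  assumes f: "f \<in> borel_measurable M" "integrable M (\<lambda>x. (f x)\<^sup>2)"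
    and e: "\<And>j. j < m \<Longrightarrow> e j \<in> borel_measurable M" "\<And>j. j < m \<Longrightarrow> integrable M (\<lambda>x. (e j x)\<^sup>2)"
    and orth: "\<And>j k. j < m \<Longrightarrow> k < m \<Longrightarrow> (LINT x|M. e j x * e k x) = (if j = k then 1 else 0 :: real)"
  shows "integrable M (\<lambda>x. (f x - (\<Sum>j<m. t j * e j x))\<^sup>2)"
    and "(LINT x|M. (f x - (\<Sum>j<m. t j * e j x))\<^sup>2) =
      (LINT x|M. (f x)\<^sup>2) - 2 * (\<Sum>j<m. t j * (LINT x|M. f x * e j x)) + (\<Sum>j<m. (t j)\<^sup>2)"
proof -
  have fe: "integrable M (\<lambda>x. f x * e j x)" if "j < m" for j
    using that by (intro integrable_mult_of_squares f e)
  have ee: "integrable M (\<lambda>x. e j x * e k x)" if "j < m" "k < m" for j k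
    using that by (intro integrable_mult_of_squares e)
  have eq: "(f x - (\<Sum>j<m. t j * e j x))\<^sup>2 =
      (f x)\<^sup>2 - 2 * (\<Sum>j<m. t j * (f x * e j x)) + (\<Sum>j<m. \<Sum>k<m. t j * t k * (e j x * e k x))" for x
    by (simp add: power2_diff) (simp add: power2_eq_square sum_distrib_left sum_distrib_right mult_ac)
  have I: "integrable M (\<lambda>x. \<Sum>j<m. t j * (f x * e j x))"
    "integrable M (\<lambda>x. \<Sum>j<m. \<Sum>k<m. t j * t k * (e j x * e k x))"
    using fe ee by (auto intro!: Bochner_Integration.integrable_sum integrable_mult_right)
  show "integrable M (\<lambda>x. (f x - (\<Sum>j<m. t j * e j x))\<^sup>2)"
    unfolding eq using f I by auto
  have "(LINT x|M. (\<Sum>j<m. t j * (f x * e j x))) = (\<Sum>j<m. t j * (LINT x|M. f x * e j x))"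
    using fe by (subst Bochner_Integration.integral_sum) auto
  moreover have "(LINT x|M. (\<Sum>j<m. \<Sum>k<m. t j * t k * (e j x * e k x))) = (\<Sum>j<m. (t j)\<^sup>2)"
  proof -
    have "(LINT x|M. (\<Sum>j<m. \<Sum>k<m. t j * t k * (e j x * e k x))) =
        (\<Sum>j<m. \<Sum>k<m. t j * t k * (LINT x|M. e j x * e k x))"
      using ee by (subst Bochner_Integration.integral_sum, (auto intro!: Bochner_Integration.integrable_sum)[1])
        (intro sum.cong refl, subst Bochner_Integration.integral_sum, auto)
    also have "\<dots> = (\<Sum>j<m. \<Sum>k<m. if j = k then t j * t k else 0)"
      by (intro sum.cong refl) (simp add: orth)
    also have "\<dots> = (\<Sum>j<m. (t j)\<^sup>2)"
      by (intro sum.cong refl, subst sum.delta') (auto simp: power2_eq_square)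
    finally show ?thesis .
  qed
  ultimately show "(LINT x|M. (f x - (\<Sum>j<m. t j * e j x))\<^sup>2) =
      (LINT x|M. (f x)\<^sup>2) - 2 * (\<Sum>j<m. t j * (LINT x|M. f x * e j x)) + (\<Sum>j<m. (t j)\<^sup>2)"
    unfolding eq using f I by simp
qed

lemma orthonormal_best_approximation:
  fixes f :: "'a \<Rightarrow> real" and e :: "nat \<Rightarrow> 'a \<Rightarrow> real"
  assumes "f \<in> borel_measurable M" "integrable M (\<lambda>x. (f x)\<^sup>2)"
    and "\<And>j. j < m \<Longrightarrow> e j \<in> borel_measurable M" "\<And>j. j < m \<Longrightarrow> integrable M (\<lambda>x. (e j x)\<^sup>2)"
    and "\<And>j k. j < m \<Longrightarrow> k < m \<Longrightarrow> (LINT x|M. e j x * e k x) = (if j = k then 1 else 0 :: real)"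
  shows "(LINT x|M. (f x - (\<Sum>j<m. (LINT y|M. f y * e j y) * e j x))\<^sup>2)
    \<le> (LINT x|M. (f x - (\<Sum>j<m. t j * e j x))\<^sup>2)"
proof -
  let ?p = "\<lambda>j. LINT y|M. f y * e j y"
  \<comment> \<open>This sum is exactly the difference of the two squared errors.\<close>
  have "0 \<le> (\<Sum>j<m. (t j - ?p j)\<^sup>2)"
    by (intro sum_nonneg) auto
  also have "\<dots> = (\<Sum>j<m. (t j)\<^sup>2) - 2 * (\<Sum>j<m. t j * ?p j) + (\<Sum>j<m. ?p j * ?p j)"
  proof -
    have "(t j - ?p j)\<^sup>2 = (t j)\<^sup>2 - 2 * (t j * ?p j) + ?p j * ?p j" for j
      by (simp add: power2_eq_square algebra_simps)
    then show ?thesis by (simp only: sum.distrib sum_subtractf sum_distrib_left)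
  qed
  finally show ?thesis
    using orthonormal_expansion(2)[OF assms, of m ?p] orthonormal_expansion(2)[OF assms, of m t]
    by (simp add: power2_eq_square)
qed

subsection \<open>Least squares from random samples\<close>

text \<open>The sampling density is the normalised Christoffel function
  \<open>u = (1/m) \<Sum>j<m. (e j)\<^sup>2\<close>, for which \<open>(e j)\<^sup>2 / u \<le> m\<close>.  The potential that is kept small while
  the points are chosen adds the distance of the empirical Gram matrix \<open>G\<close> to the
  identity and the mean square of the empirical inner products of the residual \<open>g\<close> with \<open>e j\<close>.\<close>

lemma exists_least_squares_points:
  fixes ev :: "'a \<Rightarrow> 'b \<Rightarrow> real" and e :: "nat \<Rightarrow> 'b \<Rightarrow> real"
  assumes "prob_space \<mu>" "prob_space w" and m: "0 < m" and \<tau>: "0 < \<tau>"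
    and ev [measurable]: "(\<lambda>(f, x). ev f x) \<in> borel_measurable (\<mu> \<Otimes>\<^sub>M w)"
    and evsq: "\<And>f. f \<in> space \<mu> \<Longrightarrow> integrable w (\<lambda>x. (ev f x)\<^sup>2)"
    and e [measurable]: "\<And>j. j < m \<Longrightarrow> e j \<in> borel_measurable w"
    and esq: "\<And>j. j < m \<Longrightarrow> integrable w (\<lambda>x. (e j x)\<^sup>2)"
    and orth: "\<And>j k. j < m \<Longrightarrow> k < m \<Longrightarrow> (LINT x|w. e j x * e k x) = (if j = k then 1 else 0 :: real)"
    and tail: "(\<integral>\<^sup>+f. \<integral>\<^sup>+x. ennreal ((ev f x - (\<Sum>j<m. (LINT y|w. ev f y * e j y) * e j x))\<^sup>2) \<partial>w \<partial>\<mu>) \<le> ennreal \<tau>"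
    and Q: "AE x in w. Q x"
  shows "\<exists>x c. (\<forall>k<32*m^3. Q (x k)) \<and>
    (\<integral>\<^sup>+f. \<integral>\<^sup>+z. ennreal ((ev f z - (\<Sum>j<m. (\<Sum>k<32*m^3. c j k * ev f (x k)) * e j z))\<^sup>2) \<partial>w \<partial>\<mu>) \<le> ennreal (3 * \<tau>)"
proof -
  interpret mu: prob_space \<mu> by fact
  interpret w: prob_space w by fact
  interpret mw: pair_prob_space \<mu> w ..
  define N where "N = 32 * m^3"
  have N: "real N = 32 * real m ^ 3" and Npos: "0 < N" using m by (simp_all add: N_def)
  define p where "p f j = (LINT y|w. ev f y * e j y)" for f j
  define g where "g f x = ev f x - (\<Sum>j<m. p f j * e j x)" for f x
  have p_meas [measurable]: "(\<lambda>f. p f j) \<in> borel_measurable \<mu>" if "j < m" for j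
    unfolding p_def using that by measurable
  have g_meas [measurable]: "(\<lambda>(f, x). g f x) \<in> borel_measurable (\<mu> \<Otimes>\<^sub>M w)"
    unfolding g_def by measurable
  have evf: "ev f \<in> borel_measurable w" if "f \<in> space \<mu>" for f
    using measurable_compose[OF measurable_Pair1'[OF that] ev] by simp
  have gf: "g f \<in> borel_measurable w" if "f \<in> space \<mu>" for f
    using measurable_compose[OF measurable_Pair1'[OF that] g_meas] by simp
  have gsq: "integrable w (\<lambda>x. (g f x)\<^sup>2)" if "f \<in> space \<mu>" for f
    unfolding g_def using that by (intro orthonormal_expansion(1) evf evsq e esq orth)
  have ee: "integrable w (\<lambda>x. e j x * e k x)" if "j < m" "k < m" for j k
    using that by (intro integrable_mult_of_squares e esq)
  have g_orth: "(LINT x|w. g f x * e k x) = 0" if "f \<in> space \<mu>" "k < m" for f k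
  proof -
    have "(LINT x|w. g f x * e k x) = (LINT x|w. ev f x * e k x - (\<Sum>j<m. p f j * (e j x * e k x)))"
      by (simp add: g_def left_diff_distrib sum_distrib_right mult.assoc)
    also have "\<dots> = p f k - (\<Sum>j<m. p f j * (LINT x|w. e j x * e k x))"
      using that ee evf evsq e esq
      by (subst Bochner_Integration.integral_diff)
        (auto simp: p_def intro!: integrable_mult_of_squares Bochner_Integration.integrable_sum integrable_mult_right)
    also have "\<dots> = 0"
      using that by (simp add: orth if_distrib cong: if_cong)
    finally show ?thesis .
  qed
  define u where "u x = (\<Sum>j<m. (e j x)\<^sup>2) / m" for x
  have u_meas [measurable]: "u \<in> borel_measurable w"
    unfolding u_def[abs_def] by measurable
  have u_nonneg: "0 \<le> u x" for x by (simp add: u_def sum_nonneg)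
  have e_le_u: "(e j x)\<^sup>2 \<le> m * u x" if "j < m" for j x
    using that m member_le_sum[of j "{..<m}" "\<lambda>j. (e j x)\<^sup>2"] by (simp add: u_def)
  have e0: "e j x = 0" if "u x = 0" "j < m" for j x
    using e_le_u[OF that(2), of x] that(1) by simp
  have ui: "integrable w u"
    unfolding u_def[abs_def] using esq
    by (intro Bochner_Integration.integrable_divide Bochner_Integration.integrable_sum) auto
  have "(LINT x|w. (\<Sum>j<m. (e j x)\<^sup>2)) = (\<Sum>j<m. LINT x|w. (e j x)\<^sup>2)"
    using esq by (intro Bochner_Integration.integral_sum) auto
  also have "\<dots> = real m"
    using orth by (simp add: power2_eq_square)
  finally have u1: "(LINT x|w. u x) = 1"
    unfolding u_def[abs_def] using m by simp
  define \<kappa> where "\<kappa> = density w (\<lambda>x. ennreal (u x))"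
  have sets_k [measurable_cong, simp]: "sets \<kappa> = sets w" by (simp add: \<kappa>_def)
  have space_k: "space \<kappa> = space w" by (simp add: \<kappa>_def)
  have "emeasure \<kappa> (space \<kappa>) = (\<integral>\<^sup>+x. ennreal (u x) \<partial>w)"
    by (simp add: \<kappa>_def emeasure_density cong: nn_integral_cong)
  also have "\<dots> = 1"
    using ui u1 u_nonneg by (subst nn_integral_eq_integral) auto
  finally have k1: "emeasure \<kappa> (space \<kappa>) = 1" .
  interpret k: prob_space \<kappa> using k1 by (rule prob_spaceI)
  interpret mk: pair_prob_space \<mu> \<kappa> ..
  have sets_mk [measurable_cong]: "sets (\<mu> \<Otimes>\<^sub>M \<kappa>) = sets (\<mu> \<Otimes>\<^sub>M w)"
    by (intro sets_pair_measure_cong) auto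
  have nn_mk: "(\<integral>\<^sup>+z. F z \<partial>(\<mu> \<Otimes>\<^sub>M \<kappa>)) = (\<integral>\<^sup>+f. \<integral>\<^sup>+x. ennreal (u x) * F (f, x) \<partial>w \<partial>\<mu>)"
    if [measurable]: "F \<in> borel_measurable (\<mu> \<Otimes>\<^sub>M w)" for F
  proof -
    have "(\<integral>\<^sup>+z. F z \<partial>(\<mu> \<Otimes>\<^sub>M \<kappa>)) = (\<integral>\<^sup>+f. \<integral>\<^sup>+x. F (f, x) \<partial>\<kappa> \<partial>\<mu>)"
      by (rule k.nn_integral_fst[symmetric]) measurable
    also have "\<dots> = (\<integral>\<^sup>+f. \<integral>\<^sup>+x. ennreal (u x) * F (f, x) \<partial>w \<partial>\<mu>)"
      unfolding \<kappa>_def by (intro nn_integral_cong nn_integral_density) measurable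
    finally show ?thesis .
  qed
  have int_k: "(LINT x|\<kappa>. F x) = (LINT x|w. u x * F x)" if "F \<in> borel_measurable w" for F :: "'b \<Rightarrow> real"
    unfolding \<kappa>_def using that u_nonneg by (subst integral_density) auto
  \<comment> \<open>\<open>A\<close> and \<open>B\<close> balance the two kinds of terms:
    \<open>m\<^sup>2\<close> Gram entries with second moment at most \<open>4 * m\<close> contribute
    1 in total, and so do \<open>m\<close> inner products with second moment at most
    \<open>m * \<tau>\<close>. The sum 2 becomes \<open>2 * N\<close> after \<open>N\<close> points,
    so \<open>N = 32 * m^3\<close> leaves \<open>2 / (A * N) = 1/4\<close> for the squared distance
    of \<open>G\<close> from the identity and \<open>2 / (B * N) = \<tau> / (16 * m)\<close> for the
    inner products.\<close>
  define A where "A = 1 / (4 * real m ^ 3)"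
  define B where "B = 1 / (real m ^ 2 * \<tau>)"
  have A: "0 < A" and B: "0 < B" using m \<tau> by (simp_all add: A_def B_def)
  define \<delta> where "\<delta> i j = (if i = j then 1 else 0 :: real)" for i j :: nat
  \<comment> \<open>Where \<open>u x = 0\<close> every \<open>e j x\<close> vanishes and the
    quotients take the default value 0, so \<open>u x * Z i j x = e i x * e j x\<close> and
    \<open>u x * b0 j f x = g f x * e j x\<close> hold everywhere.\<close>
  define Z where "Z i j x = e i x * e j x / u x" for i j x
  define b0 where "b0 j f x = g f x * e j x / u x" for j f x
  define H where "H s f x = (case s of Inl (i, j) \<Rightarrow> sqrt A * (Z i j x - \<delta> i j) | Inr j \<Rightarrow> sqrt B * b0 j f x)"
    for s :: "nat \<times> nat + nat" and f x
  let ?I = "({..<m} \<times> {..<m}) <+> {..<m}"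
  have H_simps: "H (Inl (i, j)) f x = sqrt A * (Z i j x - \<delta> i j)" "H (Inr j) f x = sqrt B * b0 j f x" for i j f x
    by (simp_all add: H_def)
  have Z_meas [measurable]: "Z i j \<in> borel_measurable w" if "i < m" "j < m" for i j
    unfolding Z_def[abs_def] using that by measurable
  have b0_meas [measurable]: "(\<lambda>(f, x). b0 j f x) \<in> borel_measurable (\<mu> \<Otimes>\<^sub>M w)" if "j < m" for j
    unfolding b0_def using that by measurable
  have H_meas [measurable]: "(\<lambda>(f, x). H s f x) \<in> borel_measurable (\<mu> \<Otimes>\<^sub>M w)" if "s \<in> ?I" for s
  proof (cases s)
    case (Inl ij)
    with that obtain i j where ij: "s = Inl (i, j)" "i < m" "j < m" by (cases ij) auto
    show ?thesis unfolding ij(1) H_simps using ij(2,3) by measurable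
  next
    case (Inr j)
    with that have "j < m" by auto
    then show ?thesis unfolding Inr H_simps by measurable
  qed
  \<comment> \<open>Only one of the two factors of \<open>Z\<close> is estimated by
    \<open>(e i x)\<^sup>2 / u x \<le> m\<close>; the other keeps its integral 1. Estimating both
    would give second moments of order \<open>m\<^sup>2\<close> instead of \<open>m\<close>.\<close>
  have uZ: "u x * (Z i j x - \<delta> i j)\<^sup>2 \<le> 2 * real m * (e j x)\<^sup>2 + 2 * u x" if "i < m" "j < m" for i j x
  proof (cases "u x = 0")
    case False
    have "(Z i j x - \<delta> i j)\<^sup>2 \<le> 2 * (Z i j x)\<^sup>2 + 2 * (\<delta> i j)\<^sup>2"
      using zero_le_power2[of "Z i j x + \<delta> i j"] by (simp add: power2_sum power2_diff)
    also have "\<dots> \<le> 2 * (Z i j x)\<^sup>2 + 2" by (simp add: \<delta>_def)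
    finally have "u x * (Z i j x - \<delta> i j)\<^sup>2 \<le> u x * (2 * (Z i j x)\<^sup>2 + 2)"
      by (intro mult_left_mono u_nonneg)
    also have "\<dots> = 2 * ((e i x)\<^sup>2 * (e j x)\<^sup>2 / u x) + 2 * u x"
      using False by (simp add: Z_def power_divide power_mult_distrib field_simps power2_eq_square)
    also have "(e i x)\<^sup>2 * (e j x)\<^sup>2 / u x \<le> (m * u x) * (e j x)\<^sup>2 / u x"
      using that by (intro divide_right_mono mult_right_mono e_le_u u_nonneg) auto
    also have "\<dots> = m * (e j x)\<^sup>2" using False by simp
    finally show ?thesis by simp
  qed (use u_nonneg in simp)
  have ub0: "u x * (b0 j f x)\<^sup>2 \<le> m * (g f x)\<^sup>2" if "j < m" for j f x
  proof (cases "u x = 0")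
    case False
    have "u x * (b0 j f x)\<^sup>2 = (g f x)\<^sup>2 * ((e j x)\<^sup>2 / u x)"
      using False by (simp add: b0_def power_divide power_mult_distrib field_simps power2_eq_square)
    also have "\<dots> \<le> (g f x)\<^sup>2 * ((m * u x) / u x)"
      using that by (intro divide_right_mono mult_left_mono e_le_u u_nonneg) auto
    finally show ?thesis using False by (simp add: mult.commute)
  qed simp
  have nnZ: "(\<integral>\<^sup>+z. ennreal ((H (Inl (i, j)) (fst z) (snd z))\<^sup>2) \<partial>(\<mu> \<Otimes>\<^sub>M \<kappa>)) \<le> ennreal (A * (4 * m))"
    if ij: "i < m" "j < m" for i j
  proof -
    have F: "(\<lambda>z. ennreal ((H (Inl (i, j)) (fst z) (snd z))\<^sup>2)) \<in> borel_measurable (\<mu> \<Otimes>\<^sub>M w)"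
      unfolding H_simps using ij by measurable
    have "(\<integral>\<^sup>+z. ennreal ((H (Inl (i, j)) (fst z) (snd z))\<^sup>2) \<partial>(\<mu> \<Otimes>\<^sub>M \<kappa>)) =
       (\<integral>\<^sup>+f. \<integral>\<^sup>+x. ennreal (u x) * ennreal ((H (Inl (i, j)) f x)\<^sup>2) \<partial>w \<partial>\<mu>)"
      using nn_mk[OF F] by simp
    also have "\<dots> \<le> (\<integral>\<^sup>+f. \<integral>\<^sup>+x. ennreal (A * (2 * real m * (e j x)\<^sup>2 + 2 * u x)) \<partial>w \<partial>\<mu>)"
    proof (intro nn_integral_mono)
      fix f x
      have "u x * (H (Inl (i, j)) f x)\<^sup>2 = A * (u x * (Z i j x - \<delta> i j)\<^sup>2)"
        using A by (simp add: H_simps power_mult_distrib)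
      then have "u x * (H (Inl (i, j)) f x)\<^sup>2 \<le> A * (2 * real m * (e j x)\<^sup>2 + 2 * u x)"
        using mult_left_mono[OF uZ[OF ij, of x] less_imp_le[OF A]] by (simp only:)
      then show "ennreal (u x) * ennreal ((H (Inl (i, j)) f x)\<^sup>2) \<le> ennreal (A * (2 * real m * (e j x)\<^sup>2 + 2 * u x))"
        using u_nonneg by (simp add: ennreal_mult[symmetric] ennreal_leI)
    qed
    also have "\<dots> = (\<integral>\<^sup>+x. ennreal (A * (2 * real m * (e j x)\<^sup>2 + 2 * u x)) \<partial>w)"
      using mu.emeasure_space_1 by simp
    also have "\<dots> = ennreal (LINT x|w. A * (2 * real m * (e j x)\<^sup>2 + 2 * u x))"
      using A u_nonneg esq ui ij by (intro nn_integral_eq_integral) auto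
    also have "(LINT x|w. A * (2 * real m * (e j x)\<^sup>2 + 2 * u x)) = A * (2 * m + 2)"
      using esq ui ij orth[OF ij(2) ij(2)] u1 by (simp add: power2_eq_square)
    also have "\<dots> \<le> A * (4 * m)" using A m by simp
    finally show ?thesis by (simp add: ennreal_leI)
  qed
  have nnb: "(\<integral>\<^sup>+z. ennreal ((H (Inr j) (fst z) (snd z))\<^sup>2) \<partial>(\<mu> \<Otimes>\<^sub>M \<kappa>)) \<le> ennreal (B * m * \<tau>)"
    if j: "j < m" for j
  proof -
    have F: "(\<lambda>z. ennreal ((H (Inr j) (fst z) (snd z))\<^sup>2)) \<in> borel_measurable (\<mu> \<Otimes>\<^sub>M w)"
      unfolding H_simps using j by measurable
    have "(\<integral>\<^sup>+z. ennreal ((H (Inr j) (fst z) (snd z))\<^sup>2) \<partial>(\<mu> \<Otimes>\<^sub>M \<kappa>)) =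
       (\<integral>\<^sup>+f. \<integral>\<^sup>+x. ennreal (u x) * ennreal ((H (Inr j) f x)\<^sup>2) \<partial>w \<partial>\<mu>)"
      using nn_mk[OF F] by simp
    also have "\<dots> \<le> (\<integral>\<^sup>+f. \<integral>\<^sup>+x. ennreal (B * m) * ennreal ((g f x)\<^sup>2) \<partial>w \<partial>\<mu>)"
    proof (intro nn_integral_mono)
      fix f x
      have "u x * (H (Inr j) f x)\<^sup>2 = B * (u x * (b0 j f x)\<^sup>2)"
        using B by (simp add: H_simps power_mult_distrib)
      then have "u x * (H (Inr j) f x)\<^sup>2 \<le> B * (m * (g f x)\<^sup>2)"
        using mult_left_mono[OF ub0[OF j, of x f] less_imp_le[OF B]] by (simp only:)
      then show "ennreal (u x) * ennreal ((H (Inr j) f x)\<^sup>2) \<le> ennreal (B * m) * ennreal ((g f x)\<^sup>2)"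
        using u_nonneg B by (simp add: ennreal_mult[symmetric] ennreal_leI mult.assoc)
    qed
    also have "\<dots> = ennreal (B * m) * (\<integral>\<^sup>+f. \<integral>\<^sup>+x. ennreal ((g f x)\<^sup>2) \<partial>w \<partial>\<mu>)"
      by (simp add: nn_integral_cmult gf cong: nn_integral_cong)
    also have "\<dots> \<le> ennreal (B * m) * ennreal \<tau>"
      using tail by (intro mult_left_mono) (auto simp: g_def p_def)
    also have "\<dots> = ennreal (B * m * \<tau>)"
      using B \<tau> by (intro ennreal_mult[symmetric]) auto
    finally show ?thesis .
  qed
  have Hsq: "integrable (\<mu> \<Otimes>\<^sub>M \<kappa>) (\<lambda>z. (H s (fst z) (snd z))\<^sup>2)" if "s \<in> ?I" for s
  proof (rule integrableI_bounded)
    show "(\<lambda>z. (H s (fst z) (snd z))\<^sup>2) \<in> borel_measurable (\<mu> \<Otimes>\<^sub>M \<kappa>)"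
      using H_meas[OF that] by (simp add: split_beta')
    show "(\<integral>\<^sup>+z. ennreal (norm ((H s (fst z) (snd z))\<^sup>2)) \<partial>(\<mu> \<Otimes>\<^sub>M \<kappa>)) < \<infinity>"
      using that by (auto intro!: le_less_trans[OF nnZ] le_less_trans[OF nnb])
  qed
  have HZ: "(LINT z|(\<mu> \<Otimes>\<^sub>M \<kappa>). (H (Inl (i, j)) (fst z) (snd z))\<^sup>2) \<le> A * (4 * m)" if "i < m" "j < m" for i j
    using nnZ[OF that] Hsq[of "Inl (i, j)"] that A
    by (subst (asm) nn_integral_eq_integral) auto
  have Hb: "(LINT z|(\<mu> \<Otimes>\<^sub>M \<kappa>). (H (Inr j) (fst z) (snd z))\<^sup>2) \<le> B * m * \<tau>" if "j < m" for j
    using nnb[OF that] Hsq[of "Inr j"] that B \<tau>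
    by (subst (asm) nn_integral_eq_integral) auto
  have C: "(\<Sum>s\<in>?I. LINT z|(\<mu> \<Otimes>\<^sub>M \<kappa>). (H s (fst z) (snd z))\<^sup>2) \<le> 2"
  proof -
    have "(\<Sum>s\<in>?I. LINT z|(\<mu> \<Otimes>\<^sub>M \<kappa>). (H s (fst z) (snd z))\<^sup>2) =
      (\<Sum>ij\<in>{..<m}\<times>{..<m}. LINT z|(\<mu> \<Otimes>\<^sub>M \<kappa>). (H (Inl ij) (fst z) (snd z))\<^sup>2) +
      (\<Sum>j<m. LINT z|(\<mu> \<Otimes>\<^sub>M \<kappa>). (H (Inr j) (fst z) (snd z))\<^sup>2)"
      by (subst sum.Plus) auto
    also have "\<dots> \<le> (\<Sum>ij\<in>{..<m}\<times>{..<m}. A * (4 * m)) + (\<Sum>j<m. B * m * \<tau>)"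
      using HZ Hb by (intro add_mono sum_mono) auto
    also have "\<dots> = 2"
      using m \<tau> by (simp add: A_def B_def field_simps power2_eq_square power3_eq_cube)
    finally show ?thesis .
  qed
  have mean: "AE f in \<mu>. (LINT x|\<kappa>. H s f x) = 0" if s: "s \<in> ?I" for s
  proof (rule AE_I2)
    fix f assume f: "f \<in> space \<mu>"
    show "(LINT x|\<kappa>. H s f x) = 0"
    proof (cases s)
      case (Inl ij)
      obtain i j where ij: "s = Inl (i, j)" "i < m" "j < m" by (cases ij) (use s Inl in auto)
      have *: "u x * (sqrt A * (Z i j x - \<delta> i j)) = sqrt A * (e i x * e j x - \<delta> i j * u x)" for x
        using e0[of x i] ij(2) by (cases "u x = 0") (auto simp: Z_def algebra_simps)
      have "(LINT x|\<kappa>. H s f x) = (LINT x|w. sqrt A * (e i x * e j x - \<delta> i j * u x))"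
        unfolding ij(1) H_simps *[symmetric] using ij by (intro int_k) measurable
      also have "\<dots> = 0"
        using ij ee ui u1 orth by (simp add: \<delta>_def)
      finally show ?thesis .
    next
      case (Inr j)
      then have j: "j < m" using that by auto
      have [measurable]: "g f \<in> borel_measurable w" by (rule gf[OF f])
      have *: "u x * (sqrt B * b0 j f x) = sqrt B * (g f x * e j x)" for x
        using e0[of x j] j by (cases "u x = 0") (auto simp: b0_def)
      have "(LINT x|\<kappa>. H s f x) = (LINT x|w. sqrt B * (g f x * e j x))"
        unfolding Inr H_simps *[symmetric] b0_def using j by (intro int_k) measurable
      also have "\<dots> = 0"
        using g_orth[OF f j] by simp
      finally show ?thesis .
    qed
  qed
  have Qk: "AE x in \<kappa>. Q x"
    unfolding \<kappa>_def using Q by (subst AE_density) auto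
  have "\<exists>x. (\<forall>k<N. x k \<in> space \<kappa> \<and> Q (x k)) \<and>
     (\<forall>k<N. \<forall>s\<in>?I. integrable \<mu> (\<lambda>f. (H s f (x k))\<^sup>2)) \<and>
     (\<Sum>s\<in>?I. LINT f|\<mu>. (\<Sum>k<N. H s f (x k))\<^sup>2) \<le> real N * 2"
    using H_meas Hsq C
    by (intro exists_sample_points mean Qk mu.prob_space_axioms k.prob_space_axioms) (auto simp: split_beta')
  then obtain x where x: "\<And>k. k < N \<Longrightarrow> x k \<in> space w" "\<And>k. k < N \<Longrightarrow> Q (x k)"
    and xi: "\<And>k s. k < N \<Longrightarrow> s \<in> ?I \<Longrightarrow> integrable \<mu> (\<lambda>f. (H s f (x k))\<^sup>2)"
    and xC: "(\<Sum>s\<in>?I. LINT f|\<mu>. (\<Sum>k<N. H s f (x k))\<^sup>2) \<le> real N * 2"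
    unfolding space_k by blast
  define G where "G i j = (\<Sum>k<N. Z i j (x k)) / N" for i j
  define b where "b j f = (\<Sum>k<N. b0 j f (x k)) / N" for j f
  have S1: "(LINT f|\<mu>. (\<Sum>k<N. H (Inl (i, j)) f (x k))\<^sup>2) = A * (real N)\<^sup>2 * (G i j - \<delta> i j)\<^sup>2" for i j
  proof -
    have "(\<Sum>k<N. H (Inl (i, j)) f (x k)) = sqrt A * real N * (G i j - \<delta> i j)" for f
      using Npos by (simp add: H_simps sum_distrib_left[symmetric] sum_subtractf G_def field_simps)
    then show ?thesis using A mu.prob_space by (simp add: power_mult_distrib)
  qed
  have S2: "(LINT f|\<mu>. (\<Sum>k<N. H (Inr j) f (x k))\<^sup>2) = B * (real N)\<^sup>2 * (LINT f|\<mu>. (b j f)\<^sup>2)" for j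
  proof -
    have "(\<Sum>k<N. H (Inr j) f (x k)) = sqrt B * real N * b j f" for f
      using Npos by (simp add: H_simps sum_distrib_left[symmetric] b_def)
    then show ?thesis using B by (simp add: power_mult_distrib)
  qed
  have tot: "A * (real N)\<^sup>2 * (\<Sum>i<m. \<Sum>j<m. (G i j - \<delta> i j)\<^sup>2) + B * (real N)\<^sup>2 * (\<Sum>j<m. LINT f|\<mu>. (b j f)\<^sup>2) \<le> real N * 2"
    using xC by (subst (asm) sum.Plus) (auto simp: S1 S2 sum_distrib_left sum.cartesian_product')
  have "A * (real N)\<^sup>2 * (\<Sum>i<m. \<Sum>j<m. (G i j - \<delta> i j)\<^sup>2) \<le> real N * 2"
    using tot B by (smt (verit) integral_nonneg_AE mult_nonneg_nonneg sum_nonneg zero_le_power2 AE_I2)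
  then have GI: "(\<Sum>i<m. \<Sum>j<m. (G i j - \<delta> i j)\<^sup>2) \<le> 1/4"
    using m Npos by (simp add: A_def N field_simps power2_eq_square)
  have "B * (real N)\<^sup>2 * (\<Sum>j<m. LINT f|\<mu>. (b j f)\<^sup>2) \<le> real N * 2"
    using tot A by (smt (verit) mult_nonneg_nonneg sum_nonneg zero_le_power2)
  then have "16 * m * (\<Sum>j<m. LINT f|\<mu>. (b j f)\<^sup>2) \<le> \<tau>"
    using m Npos \<tau> by (simp add: B_def N field_simps power2_eq_square power3_eq_cube)
  moreover have "16 * (\<Sum>j<m. LINT f|\<mu>. (b j f)\<^sup>2) \<le> 16 * m * (\<Sum>j<m. LINT f|\<mu>. (b j f)\<^sup>2)"
    using m by (intro mult_right_mono sum_nonneg) auto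
  ultimately have bI: "16 * (\<Sum>j<m. LINT f|\<mu>. (b j f)\<^sup>2) \<le> \<tau>" by linarith
  obtain R where R: "\<And>i j. i < m \<Longrightarrow> j < m \<Longrightarrow> (\<Sum>k<m. R i k * G k j) = \<delta> i j"
    and R4: "\<And>b. (\<Sum>i<m. (\<Sum>k<m. R i k * b k)\<^sup>2) \<le> 4 * (\<Sum>k<m. (b k)\<^sup>2)"
    using left_inverse_near_identity[of G m] GI by (auto simp: \<delta>_def)
  \<comment> \<open>The normal equations of weighted least squares. Averaging the weighted samples
    of \<open>ev f\<close> against \<open>e l\<close> gives
    \<open>(\<Sum>i<m. G l i * p f i) + b l f\<close>, so the left inverse \<open>R\<close> of
    \<open>G\<close> returns \<open>p f j\<close> up to \<open>q j f\<close>, which depends on the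
    residual \<open>g f\<close> alone. This is the exactness on the span of the
    \<open>e j\<close>.\<close>
  define c where "c j k = (\<Sum>l<m. R j l * (e l (x k) / u (x k) / N))" for j k
  define q where "q j f = (\<Sum>l<m. R j l * b l f)" for j f
  have coef: "(\<Sum>k<N. c j k * ev f (x k)) = p f j + q j f" if "j < m" for j f
  proof -
    have ev_eq: "ev f y = (\<Sum>i<m. p f i * e i y) + g f y" for y
      by (simp add: g_def)
    have "(\<Sum>k<N. (e l (x k) / u (x k) / N) * ev f (x k)) = (\<Sum>i<m. G l i * p f i) + b l f" for l
    proof -
      have "(\<Sum>k<N. (e l (x k) / u (x k) / N) * ev f (x k)) =
         (\<Sum>k<N. (\<Sum>i<m. Z l i (x k) / N * p f i) + b0 l f (x k) / N)"
        by (intro sum.cong refl) (simp add: ev_eq Z_def b0_def distrib_left sum_distrib_left mult_ac)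
      also have "\<dots> = (\<Sum>i<m. (\<Sum>k<N. Z l i (x k) / N * p f i)) + b l f"
        by (simp add: sum.distrib b_def sum_divide_distrib) (rule sum.swap)
      finally show ?thesis by (simp add: G_def sum_distrib_right sum_divide_distrib)
    qed
    note inner = this
    have "(\<Sum>k<N. c j k * ev f (x k)) = (\<Sum>l<m. R j l * (\<Sum>k<N. (e l (x k) / u (x k) / N) * ev f (x k)))"
      unfolding c_def sum_distrib_right sum_distrib_left by (subst sum.swap) (simp add: mult_ac)
    also have "\<dots> = (\<Sum>l<m. \<Sum>i<m. R j l * G l i * p f i) + q j f"
      unfolding inner q_def by (simp add: distrib_left sum.distrib sum_distrib_left mult.assoc)
    also have "(\<Sum>l<m. \<Sum>i<m. R j l * G l i * p f i) = (\<Sum>i<m. (\<Sum>l<m. R j l * G l i) * p f i)"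
      by (subst sum.swap) (simp add: sum_distrib_right)
    also have "\<dots> = (\<Sum>i<m. \<delta> j i * p f i)"
      using that by (simp add: R)
    also have "\<dots> = p f j"
      using that by (simp add: \<delta>_def if_distrib[of "\<lambda>x. x * _"] cong: if_cong)
    finally show ?thesis .
  qed
  have b0x: "(\<lambda>f. b0 j f (x k)) \<in> borel_measurable \<mu>" if "j < m" "k < N" for j k
    using measurable_compose[OF measurable_Pair2'[OF x(1)[OF that(2)]] b0_meas[OF that(1)]] by simp
  have b_meas [measurable]: "b j \<in> borel_measurable \<mu>" if "j < m" for j
    unfolding b_def[abs_def] using that by (intro borel_measurable_divide borel_measurable_sum b0x) auto
  have q_meas [measurable]: "q j \<in> borel_measurable \<mu>" if "j < m" for j
    unfolding q_def[abs_def] using that by measurable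
  have bsq: "integrable \<mu> (\<lambda>f. (b j f)\<^sup>2)" if "j < m" for j
  proof -
    have "integrable \<mu> (\<lambda>f. (sqrt B * b0 j f (x k))\<^sup>2)" if "k < N" for k
      using xi[OF that InrI, of j] \<open>j < m\<close> by (simp add: H_simps)
    then have "integrable \<mu> (\<lambda>f. (b0 j f (x k))\<^sup>2)" if "k < N" for k
      using that B by (auto simp: power_mult_distrib)
    then have "integrable \<mu> (\<lambda>f. (\<Sum>k<N. b0 j f (x k))\<^sup>2)"
      using that b0x by (intro integrable_power2_sum) auto
    then show ?thesis by (simp add: b_def power_divide)
  qed
  have parseval: "(\<integral>\<^sup>+z. ennreal ((\<Sum>j<m. t j * e j z)\<^sup>2) \<partial>w) = ennreal (\<Sum>j<m. (t j)\<^sup>2)" for t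
    using orthonormal_expansion[of "\<lambda>_. 0" w m e t] e esq orth
    by (subst nn_integral_eq_integral) auto
  \<comment> \<open>The error is the residual \<open>g\<close> minus an element of the span with
    coefficients \<open>q\<close>, and squaring doubles both parts. The first contributes
    \<open>2 * \<tau>\<close>; the second at most \<open>2 * 4\<close> times
    \<open>\<tau> / 16\<close>, which is below \<open>\<tau>\<close>.\<close>
  have "(\<integral>\<^sup>+f. \<integral>\<^sup>+z. ennreal ((ev f z - (\<Sum>j<m. (\<Sum>k<N. c j k * ev f (x k)) * e j z))\<^sup>2) \<partial>w \<partial>\<mu>)
    \<le> (\<integral>\<^sup>+f. \<integral>\<^sup>+z. 2 * ennreal ((g f z)\<^sup>2) + 2 * ennreal ((\<Sum>j<m. q j f * e j z)\<^sup>2) \<partial>w \<partial>\<mu>)"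
  proof (intro nn_integral_mono)
    fix f z
    have eq: "ev f z - (\<Sum>j<m. (\<Sum>k<N. c j k * ev f (x k)) * e j z) = g f z - (\<Sum>j<m. q j f * e j z)"
      by (simp add: coef g_def distrib_right sum.distrib)
    have "(a - b)\<^sup>2 \<le> 2 * a\<^sup>2 + 2 * b\<^sup>2" for a b :: real
      using zero_le_power2[of "a + b"] by (simp add: power2_sum power2_diff)
    then have "(ev f z - (\<Sum>j<m. (\<Sum>k<N. c j k * ev f (x k)) * e j z))\<^sup>2
        \<le> 2 * (g f z)\<^sup>2 + 2 * (\<Sum>j<m. q j f * e j z)\<^sup>2"
      unfolding eq .
    then have "ennreal ((ev f z - (\<Sum>j<m. (\<Sum>k<N. c j k * ev f (x k)) * e j z))\<^sup>2)
        \<le> ennreal (2 * (g f z)\<^sup>2 + 2 * (\<Sum>j<m. q j f * e j z)\<^sup>2)"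
      by (rule ennreal_leI)
    then show "ennreal ((ev f z - (\<Sum>j<m. (\<Sum>k<N. c j k * ev f (x k)) * e j z))\<^sup>2)
        \<le> 2 * ennreal ((g f z)\<^sup>2) + 2 * ennreal ((\<Sum>j<m. q j f * e j z)\<^sup>2)"
      by (subst (asm) ennreal_plus) (auto simp: ennreal_mult)
  qed
  also have "\<dots> = (\<integral>\<^sup>+f. 2 * (\<integral>\<^sup>+z. ennreal ((g f z)\<^sup>2) \<partial>w) + 2 * ennreal (\<Sum>j<m. (q j f)\<^sup>2) \<partial>\<mu>)"
    by (intro nn_integral_cong) (simp add: nn_integral_add nn_integral_cmult gf parseval)
  also have "\<dots> \<le> (\<integral>\<^sup>+f. 2 * (\<integral>\<^sup>+z. ennreal ((g f z)\<^sup>2) \<partial>w) + ennreal (8 * (\<Sum>j<m. (b j f)\<^sup>2)) \<partial>\<mu>)"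
  proof (intro nn_integral_mono add_left_mono)
    fix f
    have "2 * (\<Sum>j<m. (q j f)\<^sup>2) \<le> 8 * (\<Sum>j<m. (b j f)\<^sup>2)"
      using R4[of "\<lambda>l. b l f"] by (simp add: q_def)
    then have "ennreal (2 * (\<Sum>j<m. (q j f)\<^sup>2)) \<le> ennreal (8 * (\<Sum>j<m. (b j f)\<^sup>2))"
      by (rule ennreal_leI)
    then show "2 * ennreal (\<Sum>j<m. (q j f)\<^sup>2) \<le> ennreal (8 * (\<Sum>j<m. (b j f)\<^sup>2))"
      by (simp add: ennreal_mult sum_nonneg)
  qed
  also have "\<dots> = 2 * (\<integral>\<^sup>+f. \<integral>\<^sup>+z. ennreal ((g f z)\<^sup>2) \<partial>w \<partial>\<mu>) + (\<integral>\<^sup>+f. ennreal (8 * (\<Sum>j<m. (b j f)\<^sup>2)) \<partial>\<mu>)"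
    by (subst nn_integral_add) (auto simp: nn_integral_cmult)
  also have "\<dots> \<le> 2 * ennreal \<tau> + ennreal \<tau>"
  proof (intro add_mono mult_left_mono)
    show "(\<integral>\<^sup>+f. \<integral>\<^sup>+z. ennreal ((g f z)\<^sup>2) \<partial>w \<partial>\<mu>) \<le> ennreal \<tau>"
      using tail by (simp add: g_def p_def)
    have "(\<integral>\<^sup>+f. ennreal (8 * (\<Sum>j<m. (b j f)\<^sup>2)) \<partial>\<mu>) = ennreal (8 * (\<Sum>j<m. LINT f|\<mu>. (b j f)\<^sup>2))"
      using bsq by (subst nn_integral_eq_integral) (auto intro!: sum_nonneg)
    also have "\<dots> \<le> ennreal \<tau>"
      using bI \<tau> by (intro ennreal_leI) linarith
    finally show "(\<integral>\<^sup>+f. ennreal (8 * (\<Sum>j<m. (b j f)\<^sup>2)) \<partial>\<mu>) \<le> ennreal \<tau>" .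
  qed simp
  also have "2 * ennreal \<tau> + ennreal \<tau> = ennreal (\<tau> + \<tau> + \<tau>)"
    using \<tau> by (simp only: ennreal_plus mult_2 add_nonneg_nonneg less_imp_le)
  also have "\<tau> + \<tau> + \<tau> = 3 * \<tau>" by simp
  finally have "(\<integral>\<^sup>+f. \<integral>\<^sup>+z. ennreal ((ev f z - (\<Sum>j<m. (\<Sum>k<N. c j k * ev f (x k)) * e j z))\<^sup>2) \<partial>w \<partial>\<mu>) \<le> ennreal (3 * \<tau>)" .
  then show ?thesis
    using x(2) unfolding N_def by blast
qed

subsection \<open>Gaussian functionals\<close>

lemma (in prob_space) normal_distributed_facts:
  assumes \<sigma>: "0 < \<sigma>" and X: "distributed M lborel X (\<lambda>t. ennreal (normal_density 0 \<sigma> t))"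
  shows "integrable M (\<lambda>x. (X x)\<^sup>2)" "(LINT x|M. (X x)\<^sup>2) = \<sigma>\<^sup>2"
    "integrable M (\<lambda>x. (X x)^4)" "(LINT x|M. (X x)^4) = 3 * \<sigma>^4"
    "(CLINT x|M. iexp (X x)) = exp (- complex_of_real (\<sigma>\<^sup>2) / 2)"
proof -
  have nn: "0 \<le> normal_density 0 \<sigma> x" for x by simp
  have mX [measurable]: "X \<in> borel_measurable M"
    using X by (simp add: distributed_def)
  show "integrable M (\<lambda>x. (X x)\<^sup>2)"
    using integrable_normal_moment[OF \<sigma>, of 0 2] distributed_integrable[OF X, of "\<lambda>x. x\<^sup>2"] by simp
  show "integrable M (\<lambda>x. (X x)^4)"
    using integrable_normal_moment[OF \<sigma>, of 0 4] distributed_integrable[OF X, of "\<lambda>x. x^4"] by simp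
  show "(LINT x|M. (X x)\<^sup>2) = \<sigma>\<^sup>2"
    using integral_normal_moment_even[OF \<sigma>, of 0 1] distributed_integral[OF X, of "\<lambda>x. x\<^sup>2"] \<sigma>
    by (simp add: fact_numeral)
  show "(LINT x|M. (X x)^4) = 3 * \<sigma>^4"
    using integral_normal_moment_even[OF \<sigma>, of 0 2] distributed_integral[OF X, of "\<lambda>x. x^4"] \<sigma>
    by (simp add: fact_numeral field_simps)
  have "distributed M lborel (\<lambda>x. (X x - 0) / \<sigma>) std_normal_density"
    using X normal_standard_normal_convert[OF \<sigma>, of X 0] by simp
  then have Y: "distr M lborel (\<lambda>x. X x / \<sigma>) = density lborel std_normal_density"
    by (simp add: distributed_def)
  have "(CLINT x|M. iexp (X x)) = (CLINT x|M. iexp (\<sigma> * (X x / \<sigma>)))"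
    using \<sigma> by simp
  also have "\<dots> = (CLINT y|distr M lborel (\<lambda>x. X x / \<sigma>). iexp (\<sigma> * y))"
    by (subst integral_distr) auto
  also have "\<dots> = char std_normal_distribution \<sigma>"
    unfolding Y char_def by simp
  also have "\<dots> = exp (- complex_of_real (\<sigma>\<^sup>2) / 2)"
    by (simp add: char_std_normal_distribution exp_of_real[symmetric])
  finally show "(CLINT x|M. iexp (X x)) = exp (- complex_of_real (\<sigma>\<^sup>2) / 2)" .
qed

section \<open>The average case setting in one fixed dimension\<close>

locale average_case =
  fixes d :: nat and D :: "pt set" and \<rho> :: "pt \<Rightarrow> real" and F :: "fn set"
    and nF :: "fn \<Rightarrow> real" and \<mu> :: "fn measure"
  assumes setting: "avg_setting d D \<rho> F nF \<mu>"
begin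

abbreviation w :: "pt measure" where "w \<equiv> weight_measure d D \<rho>"
abbreviation \<Lambda> :: "(fn \<Rightarrow> real) set" where "\<Lambda> \<equiv> Lambda_all F nF"

lemma D_meas [measurable]: "D \<in> sets (lebesgue_d d)"
  and \<rho>_meas [measurable]: "\<rho> \<in> borel_measurable (lebesgue_d d)"
  and \<rho>_mass: "(\<integral>\<^sup>+ x. indicator D x * ennreal (\<rho> x) \<partial>lebesgue_d d) = 1"
  and F_banach: "banach_fun_space F nF" and F_separable: "separable_fun_space F nF"
  and F_outside: "\<And>f x. f \<in> F \<Longrightarrow> x \<notin> D \<Longrightarrow> f x = 0"
  and F_meas': "\<And>f. f \<in> F \<Longrightarrow> f \<in> borel_measurable (lebesgue_d d)"
  and F_embedding: "\<exists>C. \<forall>f\<in>F. (\<integral>\<^sup>+ x. ennreal ((f x)\<^sup>2) \<partial>w) \<le> ennreal ((C * nF f)\<^sup>2)"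
  and F_eval: "\<And>x. x \<in> D \<Longrightarrow> \<exists>C. \<forall>f\<in>F. \<bar>f x\<bar> \<le> C * nF f"
  and \<mu>_gaussian: "gaussian_measure F nF \<mu>"
  using setting unfolding avg_setting_def by auto

lemma sets_w [simp, measurable_cong]: "sets w = sets (lebesgue_d d)"
  and space_w [simp]: "space w = space (lebesgue_d d)"
  by (simp_all add: weight_measure_def)

lemma F_meas: "f \<in> F \<Longrightarrow> f \<in> borel_measurable w"
  using F_meas' measurable_cong_sets[OF sets_w refl] by blast

sublocale w: prob_space w
proof (rule prob_spaceI)
  have "emeasure w (space w) = (\<integral>\<^sup>+ x. indicator D x * ennreal (\<rho> x) \<partial>lebesgue_d d)"
    by (simp add: weight_measure_def emeasure_density cong: nn_integral_cong)
  then show "emeasure w (space w) = 1" by (simp add: \<rho>_mass)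
qed

lemma AE_w_D: "AE x in w. x \<in> D"
  unfolding weight_measure_def by (subst AE_density) (auto split: split_indicator_asm)

sublocale mu: prob_space \<mu>
  using \<mu>_gaussian by (simp add: gaussian_measure_def)

lemma space_\<mu> [simp]: "space \<mu> = F"
  using \<mu>_gaussian by (simp add: gaussian_measure_def)

sublocale mw: pair_prob_space \<mu> w ..

lemma F_zero: "(\<lambda>_. 0) \<in> F"
  and F_add: "f \<in> F \<Longrightarrow> g \<in> F \<Longrightarrow> (\<lambda>x. f x + g x) \<in> F"
  and F_scale: "f \<in> F \<Longrightarrow> (\<lambda>x. c * f x) \<in> F"
  and nF_nonneg: "f \<in> F \<Longrightarrow> 0 \<le> nF f"
  and nF_add: "f \<in> F \<Longrightarrow> g \<in> F \<Longrightarrow> nF (\<lambda>x. f x + g x) \<le> nF f + nF g"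
  using F_banach unfolding banach_fun_space_def normed_fun_space_def by auto

lemma F_diff: "f \<in> F \<Longrightarrow> g \<in> F \<Longrightarrow> (\<lambda>x. f x - g x) \<in> F"
  using F_add[of f "\<lambda>x. -1 * g x"] F_scale[of g "-1"] by simp

text \<open>Balls around the members of a dense sequence are the events from which the joint
  measurability of point evaluation is built; the sigma-algebra of \<open>\<mu>\<close> is generated
  by the norm-open sets.\<close>

lemma ball_measurable:
  assumes s: "s \<in> F"
  shows "{f \<in> F. nF (\<lambda>x. f x - s x) < e} \<in> sets \<mu>"
proof -
  let ?B = "{f \<in> F. nF (\<lambda>x. f x - s x) < e}"
  have "norm_open F nF ?B"
    unfolding norm_open_def
  proof (intro conjI ballI)
    fix f assume "f \<in> ?B"
    then have f: "f \<in> F" "nF (\<lambda>x. f x - s x) < e" by auto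
    show "\<exists>r>0. \<forall>g\<in>F. nF (\<lambda>x. g x - f x) < r \<longrightarrow> g \<in> ?B"
    proof (intro exI[of _ "e - nF (\<lambda>x. f x - s x)"] conjI ballI impI)
      fix g assume g: "g \<in> F" "nF (\<lambda>x. g x - f x) < e - nF (\<lambda>x. f x - s x)"
      have "nF (\<lambda>x. (g x - f x) + (f x - s x)) \<le> nF (\<lambda>x. g x - f x) + nF (\<lambda>x. f x - s x)"
        by (intro nF_add F_diff f g s)
      then show "g \<in> ?B" using g by simp
    qed (use f in simp)
  qed auto
  moreover have "{U. norm_open F nF U} \<subseteq> Pow F"
    by (auto simp: norm_open_def)
  ultimately have "?B \<in> sets (borel_fun_space F nF)"
    unfolding borel_fun_space_def by (simp add: sets_measure_of sigma_sets.Basic)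
  then show ?thesis
    using \<mu>_gaussian by (simp add: gaussian_measure_def)
qed

text \<open>A Caratheodory function on a separable space: \<^term>\<open>f x\<close> is the limit of \<^term>\<open>g x\<close>,
  where \<^term>\<open>g\<close> is the first element of a dense sequence within a given distance of \<^term>\<open>f\<close>.\<close>

lemma eval_measurable: "(\<lambda>(f, x). f x) \<in> borel_measurable (\<mu> \<Otimes>\<^sub>M w)"
proof -
  obtain S where S: "countable S" "S \<subseteq> F" and dense: "\<forall>f\<in>F. \<forall>e>0. \<exists>g\<in>S. nF (\<lambda>x. f x - g x) < e"
    using F_separable unfolding separable_fun_space_def by blast
  have "\<exists>g\<in>S. nF (\<lambda>x. 0 - g x) < 1"
    using bspec[OF dense F_zero, THEN spec, of 1] by simp
  then have "S \<noteq> {}" by auto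
  define s where "s = from_nat_into S"
  have rs: "range s = S" unfolding s_def using S(1) \<open>S \<noteq> {}\<close> by (rule range_from_nat_into[rotated])
  then have sF: "s i \<in> F" for i using S(2) by auto
  define k where "k n f = (LEAST i. nF (\<lambda>x. f x - s i x) < 1 / real (Suc n))" for n f
  have k: "nF (\<lambda>x. f x - s (k n f) x) < 1 / real (Suc n)" if f: "f \<in> F" for n f
  proof -
    have "0 < 1 / real (Suc n)" by simp
    then obtain g where g: "g \<in> S" "nF (\<lambda>x. f x - g x) < 1 / real (Suc n)"
      using bspec[OF dense f, THEN spec, of "1 / real (Suc n)"] by auto
    from g(1) obtain i where "g = s i" using rs by auto
    with g(2) have "nF (\<lambda>x. f x - s i x) < 1 / real (Suc n)" by simp
    then show ?thesis unfolding k_def by (rule LeastI)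
  qed
  have [measurable]: "k n \<in> measurable \<mu> (count_space UNIV)" for n
    unfolding k_def[abs_def]
  proof (rule measurable_Least)
    show "Measurable.pred \<mu> (\<lambda>f. nF (\<lambda>x. f x - s i x) < 1 / real (Suc n))" for i
      using ball_measurable[OF sF] by (simp add: pred_def)
  qed
  have [measurable]: "s i \<in> borel_measurable w" for i using F_meas sF by blast
  show ?thesis
  proof (rule borel_measurable_LIMSEQ_real[where u="\<lambda>n (f, x). s (k n f) x"])
    show "(\<lambda>(f, x). s (k n f) x) \<in> borel_measurable (\<mu> \<Otimes>\<^sub>M w)" for n
    proof -
      have "(\<lambda>p. s (k n (fst p)) (snd p)) \<in> borel_measurable (\<mu> \<Otimes>\<^sub>M w)"
        by (rule measurable_compose_countable[where f="\<lambda>i p. s i (snd p)"]) measurable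
      then show ?thesis by (simp add: split_beta')
    qed
  next
    fix p assume "p \<in> space (\<mu> \<Otimes>\<^sub>M w)"
    then obtain f x where p: "p = (f, x)" "f \<in> F" by (auto simp: space_pair_measure)
    have "(\<lambda>n. s (k n f) x) \<longlonglongrightarrow> f x"
    proof (cases "x \<in> D")
      case True
      then obtain C where C: "\<And>g. g \<in> F \<Longrightarrow> \<bar>g x\<bar> \<le> C * nF g" using F_eval by blast
      have "(\<lambda>n. f x - s (k n f) x) \<longlonglongrightarrow> 0"
      proof (rule Lim_null_comparison)
        have "\<bar>f x - s (k n f) x\<bar> \<le> \<bar>C\<bar> * (1 / real (Suc n))" for n
        proof -
          have "\<bar>f x - s (k n f) x\<bar> \<le> C * nF (\<lambda>x. f x - s (k n f) x)"
            using C[OF F_diff[OF p(2) sF]] by simp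
          also have "\<dots> \<le> \<bar>C\<bar> * nF (\<lambda>x. f x - s (k n f) x)"
            by (intro mult_right_mono nF_nonneg F_diff p sF) auto
          also have "\<dots> \<le> \<bar>C\<bar> * (1 / real (Suc n))"
            using k[OF p(2), of n] by (intro mult_left_mono) auto
          finally show ?thesis .
        qed
        then show "\<forall>\<^sub>F n in sequentially. norm (f x - s (k n f) x) \<le> \<bar>C\<bar> * (1 / real (Suc n))"
          by simp
        show "(\<lambda>n. \<bar>C\<bar> * (1 / real (Suc n))) \<longlonglongrightarrow> 0"
          using tendsto_mult_right_zero[OF LIMSEQ_inverse_real_of_nat] by (simp add: divide_inverse)
      qed
      from tendsto_diff[OF tendsto_const[of "f x"] this] show ?thesis by simp
    next
      case False
      then show ?thesis using F_outside[OF p(2)] F_outside[OF sF] by simp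
    qed
    then show "(\<lambda>n. (case p of (f, x) \<Rightarrow> s (k n f) x)) \<longlonglongrightarrow> (case p of (f, x) \<Rightarrow> f x)"
      using p by simp
  qed
qed

lemma F_sq_finite: "f \<in> F \<Longrightarrow> (\<integral>\<^sup>+ x. ennreal ((f x)\<^sup>2) \<partial>w) < \<infinity>"
  using F_embedding ennreal_less_top le_less_trans by fastforce

lemma F_sq_integrable: "f \<in> F \<Longrightarrow> integrable w (\<lambda>x. (f x)\<^sup>2)"
  using F_sq_finite F_meas by (intro integrableI_bounded) auto

section \<open>Continuous linear functionals and their Gaussian moments\<close>

lemma Lambda_eval: "x \<in> D \<Longrightarrow> (\<lambda>f. f x) \<in> \<Lambda>"
  using F_eval by (auto simp: Lambda_all_def)

lemma Lambda_std_subset: "Lambda_std D \<subseteq> \<Lambda>"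
  using Lambda_eval by (auto simp: Lambda_std_def)

lemma Lambda_add:
  assumes "L \<in> \<Lambda>" "L' \<in> \<Lambda>"
  shows "(\<lambda>f. L f + L' f) \<in> \<Lambda>"
proof -
  obtain C C' where "\<And>f. f \<in> F \<Longrightarrow> \<bar>L f\<bar> \<le> C * nF f" "\<And>f. f \<in> F \<Longrightarrow> \<bar>L' f\<bar> \<le> C' * nF f"
    using assms unfolding Lambda_all_def by blast
  then have "\<forall>f\<in>F. \<bar>L f + L' f\<bar> \<le> (C + C') * nF f"
    by (auto simp: distrib_right intro!: order_trans[OF abs_triangle_ineq] add_mono)
  then have "\<exists>C. \<forall>f\<in>F. \<bar>L f + L' f\<bar> \<le> C * nF f" by blast
  then show ?thesis
    using assms unfolding Lambda_all_def by (auto simp: algebra_simps)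
qed

lemma Lambda_scale:
  assumes "L \<in> \<Lambda>"
  shows "(\<lambda>f. c * L f) \<in> \<Lambda>"
proof -
  obtain C where "\<And>f. f \<in> F \<Longrightarrow> \<bar>L f\<bar> \<le> C * nF f"
    using assms unfolding Lambda_all_def by blast
  then have "\<forall>f\<in>F. \<bar>c * L f\<bar> \<le> (\<bar>c\<bar> * C) * nF f"
    by (auto simp: abs_mult mult.assoc intro!: mult_left_mono)
  then have "\<exists>C. \<forall>f\<in>F. \<bar>c * L f\<bar> \<le> C * nF f" by blast
  then show ?thesis
    using assms unfolding Lambda_all_def by (auto simp: algebra_simps)
qed

lemma Lambda_zero: "(\<lambda>_. 0) \<in> \<Lambda>"
  using nF_nonneg by (auto simp: Lambda_all_def intro!: exI[of _ 0])

lemma Lambda_sum: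
  fixes L :: "nat \<Rightarrow> fn \<Rightarrow> real"
  assumes "\<And>j. j < m \<Longrightarrow> L j \<in> \<Lambda>"
  shows "(\<lambda>f. \<Sum>j<m. c j * L j f) \<in> \<Lambda>"
  using assms
proof (induction m)
  case (Suc m)
  then have "(\<lambda>f. (\<Sum>j<m. c j * L j f) + c m * L m f) \<in> \<Lambda>"
    by (intro Lambda_add Lambda_scale) auto
  then show ?case by simp
qed (simp add: Lambda_zero)

text \<open>The degenerate alternative in \<open>gaussian_measure\<close>, a functional that
  vanishes almost surely, obeys the same formulas with variance 0. Later arguments therefore need no
  case distinction when linear combinations of functionals degenerate.\<close>

lemma
  assumes "L \<in> \<Lambda>"
  shows Lambda_meas: "L \<in> borel_measurable \<mu>"
    and Lambda_sq: "integrable \<mu> (\<lambda>f. (L f)\<^sup>2)"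
    and Lambda_4: "integrable \<mu> (\<lambda>f. (L f)^4)"
    and Lambda_4_eq: "(LINT f|\<mu>. (L f)^4) = 3 * (LINT f|\<mu>. (L f)\<^sup>2)\<^sup>2"
    and Lambda_char: "(CLINT f|\<mu>. iexp (L f)) = exp (- complex_of_real (LINT f|\<mu>. (L f)\<^sup>2) / 2)"
proof -
  from assms \<mu>_gaussian consider \<sigma> where "\<sigma> > 0" "distributed \<mu> lborel L (\<lambda>t. ennreal (normal_density 0 \<sigma> t))"
    | "L \<in> borel_measurable \<mu>" "AE f in \<mu>. L f = 0"
    unfolding gaussian_measure_def by blast
  then have "L \<in> borel_measurable \<mu> \<and> integrable \<mu> (\<lambda>f. (L f)\<^sup>2) \<and> integrable \<mu> (\<lambda>f. (L f)^4) \<and>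
    (LINT f|\<mu>. (L f)^4) = 3 * (LINT f|\<mu>. (L f)\<^sup>2)\<^sup>2 \<and>
    (CLINT f|\<mu>. iexp (L f)) = exp (- complex_of_real (LINT f|\<mu>. (L f)\<^sup>2) / 2)"
  proof cases
    case 1
    then show ?thesis
      using mu.normal_distributed_facts[OF 1] by (auto simp: distributed_def)
  next
    case 2
    note [measurable] = 2(1)
    have a: "AE f in \<mu>. (L f)\<^sup>2 = 0" "AE f in \<mu>. (L f)^4 = 0"
      using 2(2) by (auto elim!: eventually_mono)
    have "integrable \<mu> (\<lambda>f. (L f)\<^sup>2)" "integrable \<mu> (\<lambda>f. (L f)^4)"
      using integrable_cong_AE[OF _ _ a(1)] integrable_cong_AE[OF _ _ a(2)] by simp_all
    moreover have "(LINT f|\<mu>. (L f)\<^sup>2) = 0" "(LINT f|\<mu>. (L f)^4) = 0"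
      using integral_cong_AE[OF _ _ a(1)] integral_cong_AE[OF _ _ a(2)] by simp_all
    moreover have "(CLINT f|\<mu>. iexp (L f)) = (CLINT f|\<mu>. 1)"
      using 2(2) by (intro integral_cong_AE) (auto elim!: eventually_mono)
    ultimately show ?thesis using 2 mu.prob_space by simp
  qed
  then show "L \<in> borel_measurable \<mu>" "integrable \<mu> (\<lambda>f. (L f)\<^sup>2)" "integrable \<mu> (\<lambda>f. (L f)^4)"
    "(LINT f|\<mu>. (L f)^4) = 3 * (LINT f|\<mu>. (L f)\<^sup>2)\<^sup>2"
    "(CLINT f|\<mu>. iexp (L f)) = exp (- complex_of_real (LINT f|\<mu>. (L f)\<^sup>2) / 2)"
    by blast+
qed

lemma Lambda_mult: "L \<in> \<Lambda> \<Longrightarrow> L' \<in> \<Lambda> \<Longrightarrow> integrable \<mu> (\<lambda>f. L f * L' f)"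
  by (intro integrable_mult_of_squares Lambda_meas Lambda_sq)

text \<open>Removing an event of probability at most 1/12 removes at most half of the second moment,
  since the fourth moment of a Gaussian is three times the square of the second.\<close>

lemma Lambda_sq_truncated:
  assumes L: "L \<in> \<Lambda>" and B [measurable]: "B \<in> sets \<mu>" and PB: "mu.prob (F - B) \<le> 1/12"
  shows "(LINT f|\<mu>. (L f)\<^sup>2) \<le> 2 * (LINT f|\<mu>. (L f)\<^sup>2 * indicator B f)"
proof -
  let ?s = "LINT f|\<mu>. (L f)\<^sup>2"
  note [measurable] = Lambda_meas[OF L]
  note i2 = Lambda_sq[OF L] and i4 = Lambda_4[OF L]
  have [measurable]: "F - B \<in> sets \<mu>"
    using sets.compl_sets[OF B] by simp
  have iI: "integrable \<mu> (indicator (F - B) :: fn \<Rightarrow> real)"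
    by (intro integrable_real_indicator) (auto simp: less_top[symmetric])
  have iB: "integrable \<mu> (\<lambda>f. (L f)\<^sup>2 * indicator B f)" "integrable \<mu> (\<lambda>f. (L f)\<^sup>2 * indicator (F - B) f)"
    using i2 by (auto intro!: integrable_real_mult_indicator)
  show ?thesis
  proof (cases "?s = 0")
    case True
    then show ?thesis by simp
  next
    case False
    then have s: "?s > 0" by (simp add: order_less_le)
    \<comment> \<open>This is \<open>((L f)\<^sup>2 - 6 * ?s)\<^sup>2 \<ge> 0\<close> divided by
      \<open>12 * ?s\<close>. The 6 makes both terms integrate to at most \<open>?s / 4\<close>: the
      first because the fourth moment is \<open>3 * ?s\<^sup>2\<close>, the second because the event
      has probability at most \<open>1/12\<close>.\<close>
    have "(L f)\<^sup>2 * indicator (F - B) f \<le> (L f)^4 / (12 * ?s) + 3 * ?s * indicator (F - B) f" for f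
    proof (cases "f \<in> F - B")
      case True
      have "0 \<le> ((L f)\<^sup>2 - 6 * ?s)\<^sup>2 / (12 * ?s)" using s by simp
      also have "\<dots> = (L f)^4 / (12 * ?s) + 3 * ?s - (L f)\<^sup>2"
        using s by (simp add: power2_diff field_simps) (simp add: power2_eq_square power4_eq_xxxx)
      finally show ?thesis using True by simp
    qed (use s in simp)
    then have "(LINT f|\<mu>. (L f)\<^sup>2 * indicator (F - B) f) \<le> (LINT f|\<mu>. (L f)^4 / (12 * ?s) + 3 * ?s * indicator (F - B) f)"
      using iB i4 iI by (intro integral_mono) auto
    also have "\<dots> = (3 * ?s\<^sup>2) / (12 * ?s) + 3 * ?s * mu.prob (F - B)"
      using i4 iI Lambda_4_eq[OF L] by (subst Bochner_Integration.integral_add) (auto simp: Int_absorb2)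
    also have "\<dots> \<le> ?s / 4 + 3 * ?s * (1/12)"
      using s PB by (intro add_mono mult_left_mono) (auto simp: power2_eq_square)
    finally have 1: "(LINT f|\<mu>. (L f)\<^sup>2 * indicator (F - B) f) \<le> ?s / 2" by simp
    have "?s = (LINT f|\<mu>. (L f)\<^sup>2 * indicator B f + (L f)\<^sup>2 * indicator (F - B) f)"
      by (intro Bochner_Integration.integral_cong) (auto split: split_indicator)
    also have "\<dots> = (LINT f|\<mu>. (L f)\<^sup>2 * indicator B f) + (LINT f|\<mu>. (L f)\<^sup>2 * indicator (F - B) f)"
      using iB by simp
    finally show ?thesis using 1 by linarith
  qed
qed

text \<open>A weak form of Fernique's theorem. Each \<open>Q f\<close> is finite, so
  \<open>Q\<close> is bounded by some \<open>K\<close> on an event of probability above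
  \<open>11/12\<close>. Restricted to that event, every evaluation keeps at least half of its second
  moment, with the same constant for all \<open>x\<close>; exchanging the integrals before and after
  the restriction bounds the whole by \<open>2 * K\<close>.\<close>

lemma trace_finite: "(\<integral>\<^sup>+f. \<integral>\<^sup>+x. ennreal ((f x)\<^sup>2) \<partial>w \<partial>\<mu>) < \<infinity>"
proof -
  note [measurable] = eval_measurable
  define Q where "Q f = (\<integral>\<^sup>+x. ennreal ((f x)\<^sup>2) \<partial>w)" for f :: fn
  have Qm [measurable]: "Q \<in> borel_measurable \<mu>"
    unfolding Q_def[abs_def] by measurable
  define B where "B n = {f \<in> space \<mu>. Q f \<le> of_nat n}" for n :: nat
  have Bm [measurable]: "B n \<in> sets \<mu>" for n unfolding B_def by measurable
  have UB: "(\<Union>n. B n) = F"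
  proof (intro equalityI subsetI)
    fix f assume f: "f \<in> F"
    then have "Q f < \<infinity>" unfolding Q_def by (rule F_sq_finite)
    then obtain n :: nat where "Q f < of_nat n"
      using ennreal_Ex_less_of_nat[of "Q f"] by auto
    then show "f \<in> (\<Union>n. B n)" using f by (auto simp: B_def intro!: exI[of _ n] less_imp_le)
  qed (auto simp: B_def)
  have "incseq B"
    by (auto simp: incseq_def B_def intro: order_trans)
  then have "(\<lambda>n. mu.prob (B n)) \<longlonglongrightarrow> mu.prob (\<Union>n. B n)"
    by (intro mu.finite_Lim_measure_incseq) auto
  then have "(\<lambda>n. mu.prob (B n)) \<longlonglongrightarrow> 1"
    using UB mu.prob_space by simp
  then have "\<forall>\<^sub>F n in sequentially. 11/12 < mu.prob (B n)"
    by (rule order_tendstoD) simp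
  then obtain K where K: "11/12 < mu.prob (B K)"
    by (auto simp: eventually_sequentially)
  have PK: "mu.prob (F - B K) \<le> 1/12"
    using mu.prob_compl[OF Bm, of K] K by simp
  have "(\<integral>\<^sup>+f. \<integral>\<^sup>+x. ennreal ((f x)\<^sup>2) \<partial>w \<partial>\<mu>) = (\<integral>\<^sup>+x. \<integral>\<^sup>+f. ennreal ((f x)\<^sup>2) \<partial>\<mu> \<partial>w)"
    by (intro mw.Fubini'[symmetric]) measurable
  also have "\<dots> \<le> (\<integral>\<^sup>+x. \<integral>\<^sup>+f. 2 * (ennreal ((f x)\<^sup>2) * indicator (B K) f) \<partial>\<mu> \<partial>w)"
  proof (intro nn_integral_mono_AE)
    show "AE x in w. (\<integral>\<^sup>+f. ennreal ((f x)\<^sup>2) \<partial>\<mu>) \<le> (\<integral>\<^sup>+f. 2 * (ennreal ((f x)\<^sup>2) * indicator (B K) f) \<partial>\<mu>)"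
      using AE_w_D
    proof eventually_elim
      fix x assume x: "x \<in> D"
      note L = Lambda_eval[OF x]
      note [measurable] = Lambda_meas[OF L]
      have "(\<integral>\<^sup>+f. ennreal ((f x)\<^sup>2) \<partial>\<mu>) = ennreal (LINT f|\<mu>. (f x)\<^sup>2)"
        using Lambda_sq[OF L] by (intro nn_integral_eq_integral) auto
      also have "\<dots> \<le> ennreal (2 * (LINT f|\<mu>. (f x)\<^sup>2 * indicator (B K) f))"
        using Lambda_sq_truncated[OF L Bm PK] by (rule ennreal_leI)
      also have "\<dots> = ennreal (LINT f|\<mu>. 2 * ((f x)\<^sup>2 * indicator (B K) f))"
        by simp
      also have "\<dots> = (\<integral>\<^sup>+f. ennreal (2 * ((f x)\<^sup>2 * indicator (B K) f)) \<partial>\<mu>)"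
        using Lambda_sq[OF L] integrable_real_mult_indicator[OF Bm Lambda_sq[OF L]]
        by (intro nn_integral_eq_integral[symmetric]) (auto simp: mult.commute)
      also have "\<dots> = (\<integral>\<^sup>+f. 2 * (ennreal ((f x)\<^sup>2) * indicator (B K) f) \<partial>\<mu>)"
        by (intro nn_integral_cong) (auto simp: ennreal_mult split: split_indicator)
      finally show "(\<integral>\<^sup>+f. ennreal ((f x)\<^sup>2) \<partial>\<mu>) \<le> (\<integral>\<^sup>+f. 2 * (ennreal ((f x)\<^sup>2) * indicator (B K) f) \<partial>\<mu>)" .
    qed
  qed
  also have "\<dots> = (\<integral>\<^sup>+f. \<integral>\<^sup>+x. 2 * (ennreal ((f x)\<^sup>2) * indicator (B K) f) \<partial>w \<partial>\<mu>)"
    by (intro mw.Fubini') measurable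
  also have "\<dots> \<le> (\<integral>\<^sup>+f. 2 * of_nat K \<partial>\<mu>)"
  proof (intro nn_integral_mono)
    fix f assume "f \<in> space \<mu>"
    then have f: "f \<in> F" by simp
    note [measurable] = F_meas[OF f]
    have "(\<integral>\<^sup>+x. 2 * (ennreal ((f x)\<^sup>2) * indicator (B K) f) \<partial>w) = 2 * (Q f * indicator (B K) f)"
      by (simp add: nn_integral_cmult nn_integral_multc Q_def)
    also have "\<dots> \<le> 2 * of_nat K"
      by (intro mult_left_mono) (auto simp: B_def split: split_indicator)
    finally show "(\<integral>\<^sup>+x. 2 * (ennreal ((f x)\<^sup>2) * indicator (B K) f) \<partial>w) \<le> 2 * of_nat K" .
  qed
  also have "\<dots> < \<infinity>"
    by (simp add: mu.emeasure_space_1[simplified] ennreal_mult_less_top of_nat_less_top)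
  finally show ?thesis .
qed

lemma eval_sq_integrable: "integrable (\<mu> \<Otimes>\<^sub>M w) (\<lambda>(f, x). (f x)\<^sup>2)"
proof (rule integrableI_bounded)
  note [measurable] = eval_measurable
  show "(\<lambda>(f, x). (f x)\<^sup>2) \<in> borel_measurable (\<mu> \<Otimes>\<^sub>M w)" by measurable
  have "(\<integral>\<^sup>+z. ennreal (norm (case z of (f, x) \<Rightarrow> (f x)\<^sup>2)) \<partial>(\<mu> \<Otimes>\<^sub>M w)) = (\<integral>\<^sup>+f. \<integral>\<^sup>+x. ennreal ((f x)\<^sup>2) \<partial>w \<partial>\<mu>)"
    by (subst w.nn_integral_fst[symmetric]) auto
  then show "(\<integral>\<^sup>+z. ennreal (norm (case z of (f, x) \<Rightarrow> (f x)\<^sup>2)) \<partial>(\<mu> \<Otimes>\<^sub>M w)) < \<infinity>"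
    using trace_finite by simp
qed

subsection \<open>Linear algorithms are optimal for Gaussian measures\<close>

text \<open>As \<open>r\<close> is uncorrelated with \<open>T\<close>, the variance of
  \<open>a * r f + T f\<close> depends on \<open>a\<close> only through \<open>a\<^sup>2\<close>,
  and so does its characteristic function. The sine is a multiple of the difference between the
  exponentials for \<open>a = s\<close> and \<open>a = -s\<close>, which therefore cancel in the
  mean.\<close>

lemma Lambda_orthogonal_sin:
  fixes l :: "nat \<Rightarrow> fn \<Rightarrow> real"
  assumes l: "\<And>j. j < m \<Longrightarrow> l j \<in> \<Lambda>" and r: "r \<in> \<Lambda>"
    and orth: "\<And>j. j < m \<Longrightarrow> (LINT f|\<mu>. r f * l j f) = 0"
  shows "(CLINT f|\<mu>. complex_of_real (sin (s * r f)) * iexp (\<Sum>j<m. t j * l j f)) = 0"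
proof -
  define T where "T f = (\<Sum>j<m. t j * l j f)" for f
  have T: "T \<in> \<Lambda>" unfolding T_def[abs_def] by (intro Lambda_sum l)
  note [measurable] = Lambda_meas[OF r] Lambda_meas[OF T]
  have rT: "(LINT f|\<mu>. r f * T f) = 0"
  proof -
    have "(LINT f|\<mu>. r f * T f) = (LINT f|\<mu>. (\<Sum>j<m. t j * (r f * l j f)))"
      by (simp add: T_def sum_distrib_left mult_ac)
    also have "\<dots> = (\<Sum>j<m. LINT f|\<mu>. t j * (r f * l j f))"
      using Lambda_mult[OF r l] by (intro Bochner_Integration.integral_sum) auto
    also have "\<dots> = 0" by (simp add: orth)
    finally show ?thesis .
  qed
  have E: "(CLINT f|\<mu>. iexp (a * r f + T f)) =
      exp (- complex_of_real (a\<^sup>2 * (LINT f|\<mu>. (r f)\<^sup>2) + (LINT f|\<mu>. (T f)\<^sup>2)) / 2)" for a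
  proof -
    have L: "(\<lambda>f. a * r f + T f) \<in> \<Lambda>" by (intro Lambda_add Lambda_scale r T)
    have "(LINT f|\<mu>. (a * r f + T f)\<^sup>2) = (LINT f|\<mu>. a\<^sup>2 * (r f)\<^sup>2 + (2 * a) * (r f * T f) + (T f)\<^sup>2)"
      by (intro Bochner_Integration.integral_cong) (auto simp: power2_sum power_mult_distrib)
    also have "\<dots> = a\<^sup>2 * (LINT f|\<mu>. (r f)\<^sup>2) + (LINT f|\<mu>. (T f)\<^sup>2)"
      using Lambda_sq[OF r] Lambda_sq[OF T] Lambda_mult[OF r T] rT by simp
    finally show ?thesis using Lambda_char[OF L] by simp
  qed
  have I: "integrable \<mu> (\<lambda>f. iexp (a * r f + T f))" for a
    by (intro mu.integrable_bounded_cmod[where B=1]) auto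
  have "(CLINT f|\<mu>. complex_of_real (sin (s * r f)) * iexp (T f)) =
      (CLINT f|\<mu>. (1 / (2 * \<i>)) * (iexp (s * r f + T f) - iexp ((- s) * r f + T f)))"
  proof (intro Bochner_Integration.integral_cong refl)
    fix f
    have "complex_of_real (sin (s * r f)) = (1 / (2 * \<i>)) * (iexp (s * r f) - iexp ((- s) * r f))"
      unfolding sin_of_real[symmetric] sin_exp_eq by simp
    then show "complex_of_real (sin (s * r f)) * iexp (T f) =
        (1 / (2 * \<i>)) * (iexp (s * r f + T f) - iexp ((- s) * r f + T f))"
      by (simp only: of_real_add distrib_left exp_add left_diff_distrib mult.assoc)
  qed
  also have "\<dots> = 0"
    using I[of s] I[of "-s"] E[of s] E[of "-s"] by simp
  finally show ?thesis by (simp add: T_def)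
qed

text \<open>The argument by characteristic functions needs bounded weights, whereas \<open>r\<close>
  is unbounded. The weight \<open>sin (s * r f)\<close> is bounded and, divided by \<open>s\<close>,
  tends to \<open>r f\<close> as \<open>s\<close> tends to 0; \<open>|r f * h|\<close> dominates
  throughout.\<close>

lemma Lambda_orthogonal_expectation:
  fixes l :: "nat \<Rightarrow> fn \<Rightarrow> real"
  assumes l: "\<And>j. j < m \<Longrightarrow> l j \<in> \<Lambda>" and r: "r \<in> \<Lambda>"
    and orth: "\<And>j. j < m \<Longrightarrow> (LINT f|\<mu>. r f * l j f) = 0"
    and h [measurable]: "h \<in> borel_measurable (Pi\<^sub>M {..<m} (\<lambda>_. borel))"
    and hsq: "integrable \<mu> (\<lambda>f. (h (\<lambda>j\<in>{..<m}. l j f))\<^sup>2)"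
  shows "(LINT f|\<mu>. r f * h (\<lambda>j\<in>{..<m}. l j f)) = 0"
proof -
  let ?h = "\<lambda>f. h (\<lambda>j\<in>{..<m}. l j f)"
  have [measurable]: "(\<lambda>f. \<lambda>j\<in>{..<m}. l j f) \<in> measurable \<mu> (Pi\<^sub>M {..<m} (\<lambda>_. borel))"
    by (rule measurable_restrict) (use Lambda_meas[OF l] in auto)
  have [measurable]: "?h \<in> borel_measurable \<mu>" by measurable
  note [measurable] = Lambda_meas[OF r]
  have hi: "integrable \<mu> ?h"
    using hsq integrable_mult_of_squares[of "\<lambda>_. 1" \<mu> ?h] by simp
  have rh: "integrable \<mu> (\<lambda>f. r f * ?h f)"
    by (intro integrable_mult_of_squares Lambda_sq[OF r] hsq) auto
  have z: "(LINT f|\<mu>. sin (s * r f) * ?h f) = 0" for s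
    by (intro mu.expectation_mult_eq_0_of_char Lambda_orthogonal_sin l r orth h hi)
      (use Lambda_meas[OF l] in auto)
  define S where "S n f = real (Suc n) * (sin (inverse (real (Suc n)) * r f) * ?h f)" for n f
  have "(\<lambda>n. LINT f|\<mu>. S n f) \<longlonglongrightarrow> (LINT f|\<mu>. r f * ?h f)"
  proof (rule integral_dominated_convergence)
    show "integrable \<mu> (\<lambda>f. \<bar>r f * ?h f\<bar>)" using rh by simp
    show "AE f in \<mu>. (\<lambda>n. S n f) \<longlonglongrightarrow> r f * ?h f"
    proof (rule AE_I2)
      fix f
      \<comment> \<open>Written with \<open>sinc\<close>, the limit is continuity at 0, also at
        points where \<open>r f = 0\<close>.\<close>
      have eq: "S n f = r f * sinc (inverse (real (Suc n)) * r f) * ?h f" for n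
        by (cases "r f = 0") (auto simp: S_def field_simps)
      have "(\<lambda>n. inverse (real (Suc n)) * r f) \<longlonglongrightarrow> 0"
        using tendsto_mult_left_zero[OF LIMSEQ_inverse_real_of_nat] by simp
      then have "(\<lambda>n. sinc (inverse (real (Suc n)) * r f)) \<longlonglongrightarrow> sinc 0"
        by (rule isCont_tendsto_compose[OF isCont_sinc])
      then have "(\<lambda>n. r f * sinc (inverse (real (Suc n)) * r f) * ?h f) \<longlonglongrightarrow> r f * sinc 0 * ?h f"
        by (intro tendsto_intros)
      then show "(\<lambda>n. S n f) \<longlonglongrightarrow> r f * ?h f" by (simp add: eq)
    qed
    show "AE f in \<mu>. norm (S n f) \<le> \<bar>r f * ?h f\<bar>" for n
    proof (rule AE_I2)
      fix f
      have "\<bar>sin (inverse (real (Suc n)) * r f)\<bar> \<le> \<bar>inverse (real (Suc n)) * r f\<bar>"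
        by (rule abs_sin_x_le_abs_x)
      then have "real (Suc n) * \<bar>sin (inverse (real (Suc n)) * r f)\<bar> \<le> \<bar>r f\<bar>"
        by (simp add: abs_mult field_simps)
      then have "real (Suc n) * \<bar>sin (inverse (real (Suc n)) * r f)\<bar> * \<bar>?h f\<bar> \<le> \<bar>r f\<bar> * \<bar>?h f\<bar>"
        by (rule mult_right_mono) simp
      then show "norm (S n f) \<le> \<bar>r f * ?h f\<bar>"
        by (simp add: S_def abs_mult mult.assoc)
    qed
  qed (auto simp: S_def[abs_def])
  moreover have "(LINT f|\<mu>. S n f) = 0" for n
    using z[of "inverse (real (Suc n))"] by (simp add: S_def)
  ultimately show ?thesis by (simp add: LIMSEQ_const_iff)
qed

text \<open>Pythagoras, with no integrability asked of \<open>h\<close>: if the right-hand side is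
  finite, then \<open>h\<close> of the information is square-integrable as the difference of
  \<open>r + h\<close> and \<open>r\<close>, so orthogonality applies; if it is infinite there is
  nothing to show.\<close>

lemma Lambda_orthogonal_optimal:
  fixes l :: "nat \<Rightarrow> fn \<Rightarrow> real"
  assumes l: "\<And>j. j < m \<Longrightarrow> l j \<in> \<Lambda>" and r: "r \<in> \<Lambda>"
    and orth: "\<And>j. j < m \<Longrightarrow> (LINT f|\<mu>. r f * l j f) = 0"
    and h [measurable]: "h \<in> borel_measurable (Pi\<^sub>M {..<m} (\<lambda>_. borel))"
  shows "(\<integral>\<^sup>+f. ennreal ((r f)\<^sup>2) \<partial>\<mu>) \<le> (\<integral>\<^sup>+f. ennreal ((r f + h (\<lambda>j\<in>{..<m}. l j f))\<^sup>2) \<partial>\<mu>)"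
proof (cases "(\<integral>\<^sup>+f. ennreal ((r f + h (\<lambda>j\<in>{..<m}. l j f))\<^sup>2) \<partial>\<mu>) = \<infinity>")
  case False
  define g where "g f = h (\<lambda>j\<in>{..<m}. l j f)" for f
  have [measurable]: "(\<lambda>f. \<lambda>j\<in>{..<m}. l j f) \<in> measurable \<mu> (Pi\<^sub>M {..<m} (\<lambda>_. borel))"
    by (rule measurable_restrict) (use Lambda_meas[OF l] in auto)
  have [measurable]: "g \<in> borel_measurable \<mu>" unfolding g_def[abs_def] by measurable
  note [measurable] = Lambda_meas[OF r]
  have i1: "integrable \<mu> (\<lambda>f. (r f + g f)\<^sup>2)"
    using False unfolding g_def[symmetric] by (intro integrableI_bounded) (auto simp: less_top)
  have hsq: "integrable \<mu> (\<lambda>f. (g f)\<^sup>2)"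
    using integrable_power2_add[of "\<lambda>f. r f + g f" \<mu> "\<lambda>f. - r f"] i1 Lambda_sq[OF r] by simp
  have rh: "integrable \<mu> (\<lambda>f. r f * g f)"
    by (intro integrable_mult_of_squares Lambda_sq[OF r] hsq) auto
  have rh0: "(LINT f|\<mu>. r f * g f) = 0"
    unfolding g_def by (intro Lambda_orthogonal_expectation l r orth h hsq[unfolded g_def])
  have "(LINT f|\<mu>. (r f + g f)\<^sup>2) = (LINT f|\<mu>. (r f)\<^sup>2 + 2 * (r f * g f) + (g f)\<^sup>2)"
    by (intro Bochner_Integration.integral_cong) (auto simp: power2_sum)
  also have "\<dots> = (LINT f|\<mu>. (r f)\<^sup>2) + (LINT f|\<mu>. (g f)\<^sup>2)"
    using Lambda_sq[OF r] hsq rh rh0 by simp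
  finally have "(LINT f|\<mu>. (r f)\<^sup>2) \<le> (LINT f|\<mu>. (r f + g f)\<^sup>2)" by simp
  then show ?thesis
    unfolding g_def[symmetric] using i1 Lambda_sq[OF r] by (simp add: nn_integral_eq_integral ennreal_leI)
qed simp

lemma eval_measurable': "(\<lambda>(x, f). f x) \<in> borel_measurable (w \<Otimes>\<^sub>M \<mu>)"
  using measurable_pair_swap[OF eval_measurable] by simp

text \<open>For fixed \<open>x \<in> D\<close> the evaluation at \<open>x\<close> is itself a
  continuous functional, so linear prediction is shown optimal for each \<open>x\<close> separately
  and then integrated by Fubini. Orthonormalisation happens twice, for the information in
  \<open>L_2(\<mu>)\<close> and for the resulting coefficient functions in \<open>L_2(w)\<close>;
  either may drop vectors, whence \<open>m \<le> n\<close>.\<close>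

lemma exists_linear_approximation:
  assumes adm: "admissible_alg d D \<rho> \<Lambda> n L \<phi>"
    and err: "alg_err_sq d D \<rho> \<mu> n L \<phi> \<le> ennreal \<tau>"
  shows "\<exists>m\<le>n. \<exists>e. (\<forall>j<m. e j \<in> borel_measurable w \<and> integrable w (\<lambda>x. (e j x)\<^sup>2)) \<and>
    (\<forall>j<m. \<forall>k<m. (LINT x|w. e j x * e k x) = (if j = k then 1 else 0)) \<and>
    (\<integral>\<^sup>+f. \<integral>\<^sup>+x. ennreal ((f x - (\<Sum>j<m. (LINT y|w. f y * e j y) * e j x))\<^sup>2) \<partial>w \<partial>\<mu>) \<le> ennreal \<tau>"
proof -
  have L: "L i \<in> \<Lambda>" if "i < n" for i
    using adm that unfolding admissible_alg_def by blast
  have \<phi>: "(\<lambda>(y, x). \<phi> y x) \<in> borel_measurable (Pi\<^sub>M {..<n} (\<lambda>_. borel) \<Otimes>\<^sub>M lebesgue_d d)"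
    using adm unfolding admissible_alg_def by blast
  have \<phi>w: "(\<lambda>(y, x). \<phi> y x) \<in> borel_measurable (Pi\<^sub>M {..<n} (\<lambda>_. borel) \<Otimes>\<^sub>M w)"
    using \<phi> measurable_cong_sets[OF sets_pair_measure_cong[OF refl sets_w] refl] by blast
  have "\<exists>m\<le>n. \<exists>l a. (\<forall>j<m. l j \<in> \<Lambda>) \<and>
     (\<forall>j<m. \<forall>k<m. (LINT f|\<mu>. l j f * l k f) = (if j = k then 1 else 0)) \<and>
     (\<forall>i<n. AE f in \<mu>. L i f = (\<Sum>j<m. a i j * l j f))"
    by (rule gram_schmidt_L2[OF Lambda_meas Lambda_sq Lambda_add Lambda_scale L])
  then obtain m1 l a where m1: "m1 \<le> n" and l: "\<And>j. j < m1 \<Longrightarrow> l j \<in> \<Lambda>"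
    and l_orth: "\<And>j k. j < m1 \<Longrightarrow> k < m1 \<Longrightarrow> (LINT f|\<mu>. l j f * l k f) = (if j = k then 1 else 0)"
    and La: "\<And>i. i < n \<Longrightarrow> AE f in \<mu>. L i f = (\<Sum>j<m1. a i j * l j f)"
    by blast
  have lm [measurable]: "l j \<in> borel_measurable \<mu>" if "j < m1" for j
    by (intro Lambda_meas l that)
  have Lm [measurable]: "L i \<in> borel_measurable \<mu>" if "i < n" for i
    by (intro Lambda_meas L that)
  \<comment> \<open>Regression coefficients: \<open>\<Sum>j<m1. \<eta> j x * l j f\<close> is the
    best linear prediction of \<open>f x\<close> from the information, and the functions
    \<open>\<eta> j\<close> span the space of the final projection.\<close>
  define \<eta> where "\<eta> j x = (LINT f|\<mu>. f x * l j f)" for j x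
  have \<eta>m [measurable]: "\<eta> j \<in> borel_measurable w" if "j < m1" for j
  proof -
    have "(\<lambda>p. (\<lambda>(x, f). f x) p * l j (snd p)) \<in> borel_measurable (w \<Otimes>\<^sub>M \<mu>)"
      by (intro borel_measurable_times eval_measurable' measurable_compose[OF measurable_snd lm] that)
    then have "(\<lambda>(x, f). f x * l j f) \<in> borel_measurable (w \<Otimes>\<^sub>M \<mu>)"
      by (simp only: split_beta')
    then show ?thesis
      unfolding \<eta>_def[abs_def] by (rule mu.borel_measurable_lebesgue_integral)
  qed
  \<comment> \<open>Bessel's inequality in \<open>L_2(\<mu>)\<close>. Since the second moment of
    \<open>f x\<close> is integrable over \<open>w\<close>, it puts each \<open>\<eta> j\<close>
    into \<open>L_2(w)\<close>.\<close>
  have \<eta>_le: "(\<Sum>j<m1. (\<eta> j x)\<^sup>2) \<le> (LINT f|\<mu>. (f x)\<^sup>2)" if "x \<in> D" for x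
  proof -
    note Lx = Lambda_eval[OF that]
    have "0 \<le> (LINT f|\<mu>. (f x - (\<Sum>j<m1. \<eta> j x * l j f))\<^sup>2)" by simp
    also have "\<dots> = (LINT f|\<mu>. (f x)\<^sup>2) - 2 * (\<Sum>j<m1. \<eta> j x * (LINT f|\<mu>. f x * l j f)) + (\<Sum>j<m1. (\<eta> j x)\<^sup>2)"
      by (intro orthonormal_expansion(2) Lambda_meas[OF Lx] Lambda_sq[OF Lx] Lambda_sq[OF l] lm l_orth)
    finally show ?thesis by (simp add: \<eta>_def[symmetric] power2_eq_square)
  qed
  have int_tr: "integrable w (\<lambda>x. LINT f|\<mu>. (f x)\<^sup>2)"
    using mw.integrable_snd[OF eval_sq_integrable] by simp
  have \<eta>sq: "integrable w (\<lambda>x. (\<eta> j x)\<^sup>2)" if j: "j < m1" for j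
  proof (rule Bochner_Integration.integrable_bound[OF int_tr])
    show "AE x in w. norm ((\<eta> j x)\<^sup>2) \<le> norm (LINT f|\<mu>. (f x)\<^sup>2)"
      using AE_w_D
    proof eventually_elim
      fix x assume x: "x \<in> D"
      have "(\<eta> j x)\<^sup>2 \<le> (\<Sum>j<m1. (\<eta> j x)\<^sup>2)"
        using j by (intro member_le_sum) auto
      with \<eta>_le[OF x] show "norm ((\<eta> j x)\<^sup>2) \<le> norm (LINT f|\<mu>. (f x)\<^sup>2)" by simp
    qed
    show "(\<lambda>x. (\<eta> j x)\<^sup>2) \<in> borel_measurable w"
      by (intro borel_measurable_power \<eta>m j)
  qed
  \<comment> \<open>\<open>A\<close> recovers the original information from the orthonormal
    functionals, up to a null set, so the given algorithm becomes a measurable function of the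
    \<open>l j\<close>.\<close>
  define A where "A z = (\<lambda>i\<in>{..<n}. \<Sum>j<m1. a i j * z j)" for z :: "nat \<Rightarrow> real"
  have Am [measurable]: "A \<in> measurable (Pi\<^sub>M {..<m1} (\<lambda>_. borel)) (Pi\<^sub>M {..<n} (\<lambda>_. borel))"
    unfolding A_def[abs_def] by (rule measurable_restrict) measurable
  have pointwise: "(\<integral>\<^sup>+f. ennreal ((f x - (\<Sum>j<m1. \<eta> j x * l j f))\<^sup>2) \<partial>\<mu>)
      \<le> (\<integral>\<^sup>+f. ennreal ((f x - \<phi> (\<lambda>i\<in>{..<n}. L i f) x)\<^sup>2) \<partial>\<mu>)" if x: "x \<in> D" for x
  proof -
    note Lx = Lambda_eval[OF x]
    have xs: "x \<in> space (lebesgue_d d)" using x sets.sets_into_space[OF D_meas] by auto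
    have \<phi>x: "(\<lambda>y. \<phi> y x) \<in> borel_measurable (Pi\<^sub>M {..<n} (\<lambda>_. borel))"
      using measurable_compose[OF measurable_Pair2'[OF xs] \<phi>] by (simp only: prod.case)
    define r where "r f = f x - (\<Sum>j<m1. \<eta> j x * l j f)" for f
    have "(\<lambda>f. f x + (\<Sum>j<m1. (- \<eta> j x) * l j f)) \<in> \<Lambda>"
      by (intro Lambda_add Lx Lambda_sum l)
    then have r: "r \<in> \<Lambda>" by (simp add: r_def[abs_def] sum_negf)
    have r_orth: "(LINT f|\<mu>. r f * l k f) = 0" if k: "k < m1" for k
    proof -
      have "(LINT f|\<mu>. r f * l k f) = (LINT f|\<mu>. f x * l k f - (\<Sum>j<m1. \<eta> j x * (l j f * l k f)))"
        by (simp add: r_def left_diff_distrib sum_distrib_right mult.assoc)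
      also have "\<dots> = \<eta> k x - (\<Sum>j<m1. \<eta> j x * (LINT f|\<mu>. l j f * l k f))"
        using k Lambda_mult[OF Lx l[OF k]] Lambda_mult[OF l l[OF k]]
        by (subst Bochner_Integration.integral_diff)
          (auto simp: \<eta>_def intro!: Bochner_Integration.integrable_sum integrable_mult_right)
      also have "\<dots> = 0"
        using k by (simp add: l_orth if_distrib cong: if_cong)
      finally show ?thesis .
    qed
    \<comment> \<open>Chosen so that \<open>r f\<close> plus \<open>h\<close> of the information is
      the error of the given algorithm at \<open>x\<close>, almost surely.\<close>
    define h where "h z = (\<Sum>j<m1. \<eta> j x * z j) - \<phi> (A z) x" for z
    have h: "h \<in> borel_measurable (Pi\<^sub>M {..<m1} (\<lambda>_. borel))"
      unfolding h_def[abs_def]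
      by (intro borel_measurable_diff borel_measurable_sum borel_measurable_times borel_measurable_const
          measurable_component_singleton measurable_compose[OF Am \<phi>x]) auto
    have "(\<integral>\<^sup>+f. ennreal ((r f)\<^sup>2) \<partial>\<mu>) \<le> (\<integral>\<^sup>+f. ennreal ((r f + h (\<lambda>j\<in>{..<m1}. l j f))\<^sup>2) \<partial>\<mu>)"
      by (intro Lambda_orthogonal_optimal l r r_orth h)
    also have "\<dots> = (\<integral>\<^sup>+f. ennreal ((f x - \<phi> (\<lambda>i\<in>{..<n}. L i f) x)\<^sup>2) \<partial>\<mu>)"
    proof (rule nn_integral_cong_AE)
      have "AE f in \<mu>. \<forall>i\<in>{..<n}. L i f = (\<Sum>j<m1. a i j * l j f)"
        using La by (intro AE_finite_allI) auto
      then show "AE f in \<mu>. ennreal ((r f + h (\<lambda>j\<in>{..<m1}. l j f))\<^sup>2) =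
          ennreal ((f x - \<phi> (\<lambda>i\<in>{..<n}. L i f) x)\<^sup>2)"
      proof eventually_elim
        fix f assume "\<forall>i\<in>{..<n}. L i f = (\<Sum>j<m1. a i j * l j f)"
        then have "A (\<lambda>j\<in>{..<m1}. l j f) = (\<lambda>i\<in>{..<n}. L i f)"
          by (auto simp: A_def fun_eq_iff)
        then have "r f + h (\<lambda>j\<in>{..<m1}. l j f) = f x - \<phi> (\<lambda>i\<in>{..<n}. L i f) x"
          by (simp add: r_def h_def)
        then show "ennreal ((r f + h (\<lambda>j\<in>{..<m1}. l j f))\<^sup>2) =
          ennreal ((f x - \<phi> (\<lambda>i\<in>{..<n}. L i f) x)\<^sup>2)" by (simp only:)
      qed
    qed
    finally show ?thesis by (simp add: r_def)
  qed
  have joint: "(\<lambda>(f, x). \<phi> (\<lambda>i\<in>{..<n}. L i f) x) \<in> borel_measurable (\<mu> \<Otimes>\<^sub>M w)"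
  proof -
    have R: "(\<lambda>f. \<lambda>i\<in>{..<n}. L i f) \<in> measurable \<mu> (Pi\<^sub>M {..<n} (\<lambda>_. borel))"
      by (rule measurable_restrict) auto
    have "(\<lambda>p. ((\<lambda>i\<in>{..<n}. L i (fst p)), snd p)) \<in> measurable (\<mu> \<Otimes>\<^sub>M w) (Pi\<^sub>M {..<n} (\<lambda>_. borel) \<Otimes>\<^sub>M w)"
      using R by measurable
    from measurable_compose[OF this \<phi>w] show ?thesis
      by (simp only: split_beta' fst_conv snd_conv)
  qed
  have tail1: "(\<integral>\<^sup>+f. \<integral>\<^sup>+x. ennreal ((f x - (\<Sum>j<m1. \<eta> j x * l j f))\<^sup>2) \<partial>w \<partial>\<mu>) \<le> ennreal \<tau>"
  proof -
    have "(\<integral>\<^sup>+f. \<integral>\<^sup>+x. ennreal ((f x - (\<Sum>j<m1. \<eta> j x * l j f))\<^sup>2) \<partial>w \<partial>\<mu>) =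
      (\<integral>\<^sup>+x. \<integral>\<^sup>+f. ennreal ((f x - (\<Sum>j<m1. \<eta> j x * l j f))\<^sup>2) \<partial>\<mu> \<partial>w)"
    proof (intro mw.Fubini'[symmetric])
      note [measurable] = eval_measurable
      show "(\<lambda>(f, x). ennreal ((f x - (\<Sum>j<m1. \<eta> j x * l j f))\<^sup>2)) \<in> borel_measurable (\<mu> \<Otimes>\<^sub>M w)"
        by measurable
    qed
    also have "\<dots> \<le> (\<integral>\<^sup>+x. \<integral>\<^sup>+f. ennreal ((f x - \<phi> (\<lambda>i\<in>{..<n}. L i f) x)\<^sup>2) \<partial>\<mu> \<partial>w)"
      using AE_w_D pointwise by (intro nn_integral_mono_AE) (auto elim!: eventually_mono)
    also have "\<dots> = (\<integral>\<^sup>+f. \<integral>\<^sup>+x. ennreal ((f x - \<phi> (\<lambda>i\<in>{..<n}. L i f) x)\<^sup>2) \<partial>w \<partial>\<mu>)"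
    proof (intro mw.Fubini')
      have "(\<lambda>p. ennreal (((\<lambda>(f, x). f x) p - (\<lambda>(f, x). \<phi> (\<lambda>i\<in>{..<n}. L i f) x) p)\<^sup>2)) \<in> borel_measurable (\<mu> \<Otimes>\<^sub>M w)"
        by (intro measurable_compose[OF _ measurable_ennreal] borel_measurable_power borel_measurable_diff
            eval_measurable joint)
      then show "(\<lambda>(f, x). ennreal ((f x - \<phi> (\<lambda>i\<in>{..<n}. L i f) x)\<^sup>2)) \<in> borel_measurable (\<mu> \<Otimes>\<^sub>M w)"
        by (simp only: split_beta')
    qed
    also have "\<dots> \<le> ennreal \<tau>"
      using err by (simp add: alg_err_sq_def)
    finally show ?thesis .
  qed
  let ?S = "{g. g \<in> borel_measurable w \<and> integrable w (\<lambda>x. (g x)\<^sup>2)}"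
  have "\<exists>m\<le>m1. \<exists>e b. (\<forall>j<m. e j \<in> ?S) \<and>
     (\<forall>j<m. \<forall>k<m. (LINT x|w. e j x * e k x) = (if j = k then 1 else 0)) \<and>
     (\<forall>i<m1. AE x in w. \<eta> i x = (\<Sum>j<m. b i j * e j x))"
    by (rule gram_schmidt_L2) (auto intro: integrable_power2_add \<eta>sq \<eta>m simp: power_mult_distrib)
  then obtain m e b where m: "m \<le> m1" and e: "\<And>j. j < m \<Longrightarrow> e j \<in> borel_measurable w"
    "\<And>j. j < m \<Longrightarrow> integrable w (\<lambda>x. (e j x)\<^sup>2)"
    and orth: "\<And>j k. j < m \<Longrightarrow> k < m \<Longrightarrow> (LINT x|w. e j x * e k x) = (if j = k then 1 else 0)"
    and \<eta>b: "\<And>i. i < m1 \<Longrightarrow> AE x in w. \<eta> i x = (\<Sum>j<m. b i j * e j x)"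
    by blast
  \<comment> \<open>For fixed \<open>f\<close> the prediction, as a function of \<open>x\<close>,
    agrees almost everywhere with an element of the span of the \<open>e j\<close>, and the
    \<open>L_2(w)\<close>-projection of \<open>f\<close> onto that span is at least as
    close.\<close>
  have "(\<integral>\<^sup>+f. \<integral>\<^sup>+x. ennreal ((f x - (\<Sum>j<m. (LINT y|w. f y * e j y) * e j x))\<^sup>2) \<partial>w \<partial>\<mu>)
     \<le> (\<integral>\<^sup>+f. \<integral>\<^sup>+x. ennreal ((f x - (\<Sum>j<m1. \<eta> j x * l j f))\<^sup>2) \<partial>w \<partial>\<mu>)"
  proof (rule nn_integral_mono)
    fix f assume "f \<in> space \<mu>"
    then have f: "f \<in> F" by simp
    define t where "t i = (\<Sum>j<m1. l j f * b j i)" for i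
    have I: "integrable w (\<lambda>x. (f x - (\<Sum>j<m. s j * e j x))\<^sup>2)" for s
      by (intro orthonormal_expansion(1) F_meas[OF f] F_sq_integrable[OF f] e orth)
    have "(\<integral>\<^sup>+x. ennreal ((f x - (\<Sum>j<m. (LINT y|w. f y * e j y) * e j x))\<^sup>2) \<partial>w) =
        ennreal (LINT x|w. (f x - (\<Sum>j<m. (LINT y|w. f y * e j y) * e j x))\<^sup>2)"
      by (intro nn_integral_eq_integral I) auto
    also have "\<dots> \<le> ennreal (LINT x|w. (f x - (\<Sum>j<m. t j * e j x))\<^sup>2)"
      by (intro ennreal_leI orthonormal_best_approximation F_meas[OF f] F_sq_integrable[OF f] e orth)
    also have "\<dots> = (\<integral>\<^sup>+x. ennreal ((f x - (\<Sum>j<m. t j * e j x))\<^sup>2) \<partial>w)"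
      by (intro nn_integral_eq_integral[symmetric] I) auto
    also have "\<dots> = (\<integral>\<^sup>+x. ennreal ((f x - (\<Sum>j<m1. \<eta> j x * l j f))\<^sup>2) \<partial>w)"
    proof (rule nn_integral_cong_AE)
      have "AE x in w. \<forall>i\<in>{..<m1}. \<eta> i x = (\<Sum>j<m. b i j * e j x)"
        using \<eta>b by (intro AE_finite_allI) auto
      then show "AE x in w. ennreal ((f x - (\<Sum>j<m. t j * e j x))\<^sup>2) = ennreal ((f x - (\<Sum>j<m1. \<eta> j x * l j f))\<^sup>2)"
      proof eventually_elim
        fix x assume \<eta>x: "\<forall>i\<in>{..<m1}. \<eta> i x = (\<Sum>j<m. b i j * e j x)"
        have "(\<Sum>j<m1. \<eta> j x * l j f) = (\<Sum>j<m1. \<Sum>i<m. l j f * b j i * e i x)"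
          using \<eta>x by (intro sum.cong) (auto simp: sum_distrib_left mult_ac)
        also have "\<dots> = (\<Sum>j<m. t j * e j x)"
          unfolding t_def sum_distrib_right by (rule sum.swap)
        finally show "ennreal ((f x - (\<Sum>j<m. t j * e j x))\<^sup>2) = ennreal ((f x - (\<Sum>j<m1. \<eta> j x * l j f))\<^sup>2)"
          by simp
      qed
    qed
    finally show "(\<integral>\<^sup>+x. ennreal ((f x - (\<Sum>j<m. (LINT y|w. f y * e j y) * e j x))\<^sup>2) \<partial>w)
       \<le> (\<integral>\<^sup>+x. ennreal ((f x - (\<Sum>j<m1. \<eta> j x * l j f))\<^sup>2) \<partial>w)" .
  qed
  also note tail1
  finally have tail: "(\<integral>\<^sup>+f. \<integral>\<^sup>+x. ennreal ((f x - (\<Sum>j<m. (LINT y|w. f y * e j y) * e j x))\<^sup>2) \<partial>w \<partial>\<mu>) \<le> ennreal \<tau>" .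
  have "m \<le> n" using m m1 by simp
  moreover have "\<forall>j<m. e j \<in> borel_measurable w \<and> integrable w (\<lambda>x. (e j x)\<^sup>2)"
    using e by blast
  moreover have "\<forall>j<m. \<forall>k<m. (LINT x|w. e j x * e k x) = (if j = k then 1 else 0)"
    using orth by blast
  ultimately show ?thesis using tail by blast
qed

subsection \<open>Comparison of the two information classes\<close>

lemma min_err_sq_std_le:
  assumes m: "0 < m" and \<tau>: "0 < \<tau>"
    and e: "\<And>j. j < m \<Longrightarrow> e j \<in> borel_measurable w" "\<And>j. j < m \<Longrightarrow> integrable w (\<lambda>x. (e j x)\<^sup>2)"
    and orth: "\<And>j k. j < m \<Longrightarrow> k < m \<Longrightarrow> (LINT x|w. e j x * e k x) = (if j = k then 1 else 0)"
    and tail: "(\<integral>\<^sup>+f. \<integral>\<^sup>+x. ennreal ((f x - (\<Sum>j<m. (LINT y|w. f y * e j y) * e j x))\<^sup>2) \<partial>w \<partial>\<mu>) \<le> ennreal \<tau>"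
  shows "min_err_sq d D \<rho> \<mu> (Lambda_std D) (32 * m^3) \<le> ennreal (3 * \<tau>)"
proof -
  let ?N = "32 * m^3"
  have "\<exists>x c. (\<forall>k<?N. x k \<in> D) \<and>
    (\<integral>\<^sup>+f. \<integral>\<^sup>+z. ennreal ((f z - (\<Sum>j<m. (\<Sum>k<?N. c j k * f (x k)) * e j z))\<^sup>2) \<partial>w \<partial>\<mu>) \<le> ennreal (3 * \<tau>)"
    using tail F_sq_integrable
    by (intro exists_least_squares_points mu.prob_space_axioms w.prob_space_axioms m \<tau> eval_measurable e orth AE_w_D) auto
  then obtain x c where x: "\<And>k. k < ?N \<Longrightarrow> x k \<in> D"
    and err: "(\<integral>\<^sup>+f. \<integral>\<^sup>+z. ennreal ((f z - (\<Sum>j<m. (\<Sum>k<?N. c j k * f (x k)) * e j z))\<^sup>2) \<partial>w \<partial>\<mu>) \<le> ennreal (3 * \<tau>)"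
    by blast
  define L where "L k f = f (x k)" for k and f :: fn
  define \<phi> where "\<phi> y z = (\<Sum>j<m. (\<Sum>k<?N. c j k * y k) * e j z)" for y z
  have em [measurable]: "e j \<in> borel_measurable (lebesgue_d d)" if "j < m" for j
    using e(1)[OF that] measurable_cong_sets[OF sets_w refl] by blast
  have "admissible_alg d D \<rho> (Lambda_std D) ?N L \<phi>"
    unfolding admissible_alg_def
  proof (intro conjI ballI allI impI)
    show "L i \<in> Lambda_std D" if "i < ?N" for i
      using x[OF that] by (auto simp: Lambda_std_def L_def[abs_def])
    show "(\<lambda>(y, z). \<phi> y z) \<in> borel_measurable (Pi\<^sub>M {..<?N} (\<lambda>_. borel) \<Otimes>\<^sub>M lebesgue_d d)"
    proof -
      have "(\<lambda>p. \<Sum>j<m. (\<Sum>k<?N. c j k * fst p k) * e j (snd p))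
          \<in> borel_measurable (Pi\<^sub>M {..<?N} (\<lambda>_. borel) \<Otimes>\<^sub>M lebesgue_d d)"
        by (intro borel_measurable_sum borel_measurable_times borel_measurable_const
            measurable_compose[OF measurable_fst measurable_component_singleton]
            measurable_compose[OF measurable_snd em]) auto
      then show ?thesis unfolding \<phi>_def by (simp only: split_beta')
    qed
    fix y
    define C where "C j = (\<Sum>k<?N. c j k * y k)" for j
    have "integrable w (\<lambda>z. (\<Sum>j<m. C j * e j z)\<^sup>2)"
    proof (rule integrable_power2_sum)
      fix j assume "j \<in> {..<m}"
      then have j: "j < m" by simp
      show "(\<lambda>z. C j * e j z) \<in> borel_measurable w"
        by (intro borel_measurable_times borel_measurable_const e(1) j)
      have "integrable w (\<lambda>z. (C j)\<^sup>2 * (e j z)\<^sup>2)"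
        by (intro integrable_mult_right e(2) j)
      then show "integrable w (\<lambda>z. (C j * e j z)\<^sup>2)"
        by (simp only: power_mult_distrib)
    qed
    then have "integrable w (\<lambda>z. (\<phi> y z)\<^sup>2)"
      by (simp only: \<phi>_def C_def)
    then show "(\<integral>\<^sup>+z. ennreal ((\<phi> y z)\<^sup>2) \<partial>w) < \<infinity>"
      by (subst nn_integral_eq_integral) auto
  qed
  \<comment> \<open>Positive \<open>m\<close> makes \<open>?N\<close> positive, so the infimum
    branch of \<open>min_err_sq\<close> applies and not the one for \<open>n = 0\<close>.\<close>
  then have "min_err_sq d D \<rho> \<mu> (Lambda_std D) ?N \<le> alg_err_sq d D \<rho> \<mu> ?N L \<phi>"
    using m unfolding min_err_sq_def by (auto intro!: INF_lower2[of "(L, \<phi>)"])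
  also have "\<dots> \<le> ennreal (3 * \<tau>)"
    using err by (simp add: alg_err_sq_def L_def \<phi>_def)
  finally show ?thesis .
qed

lemma min_err_sq_all_le_std:
  "min_err_sq d D \<rho> \<mu> \<Lambda> n \<le> min_err_sq d D \<rho> \<mu> (Lambda_std D) n"
proof (cases "n = 0")
  case False
  have "{(L, \<phi>). admissible_alg d D \<rho> (Lambda_std D) n L \<phi>} \<subseteq> {(L, \<phi>). admissible_alg d D \<rho> \<Lambda> n L \<phi>}"
    using Lambda_std_subset unfolding admissible_alg_def by blast
  then show ?thesis
    using False unfolding min_err_sq_def by (simp add: INF_superset_mono)
qed (simp add: min_err_sq_def)

text \<open>The infimum need not be attained, so an algorithm with squared error below
  \<open>2 * \<delta>\<^sup>2\<close> is taken; sampling triples this, and \<open>6 \<le> 9\<close>.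
  \<open>N\<close> is bounded rather than prescribed because \<open>m\<close> may be smaller than
  \<open>n\<close>. The case \<open>m = 0\<close> projects onto the zero space, whose error is that
  of the zero algorithm, common to both classes of information.\<close>

lemma min_err_sq_std_of_all:
  assumes \<delta>: "0 < \<delta>" and all: "min_err_sq d D \<rho> \<mu> \<Lambda> n \<le> ennreal (\<delta>\<^sup>2)"
  shows "\<exists>N\<le>32 * n^3. min_err_sq d D \<rho> \<mu> (Lambda_std D) N \<le> ennreal ((3 * \<delta>)\<^sup>2)"
proof (cases "n = 0")
  case True
  have "ennreal (\<delta>\<^sup>2) \<le> ennreal ((3 * \<delta>)\<^sup>2)"
    using \<delta> by (intro ennreal_leI power_mono) auto
  moreover have "min_err_sq d D \<rho> \<mu> (Lambda_std D) 0 \<le> ennreal (\<delta>\<^sup>2)"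
    using all True by (simp add: min_err_sq_def)
  ultimately have "min_err_sq d D \<rho> \<mu> (Lambda_std D) 0 \<le> ennreal ((3 * \<delta>)\<^sup>2)"
    by (rule order_trans[rotated])
  then show ?thesis by blast
next
  case False
  have "ennreal (\<delta>\<^sup>2) < ennreal (2 * \<delta>\<^sup>2)"
    using \<delta> by (intro ennreal_lessI) auto
  with all False obtain L \<phi> where adm: "admissible_alg d D \<rho> \<Lambda> n L \<phi>"
    and err: "alg_err_sq d D \<rho> \<mu> n L \<phi> < ennreal (2 * \<delta>\<^sup>2)"
    unfolding min_err_sq_def by (auto simp: INF_less_iff dest!: le_less_trans)
  obtain m e where m: "m \<le> n"
    and e: "\<And>j. j < m \<Longrightarrow> e j \<in> borel_measurable w" "\<And>j. j < m \<Longrightarrow> integrable w (\<lambda>x. (e j x)\<^sup>2)"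
    and orth: "\<And>j k. j < m \<Longrightarrow> k < m \<Longrightarrow> (LINT x|w. e j x * e k x) = (if j = k then 1 else 0)"
    and tail: "(\<integral>\<^sup>+f. \<integral>\<^sup>+x. ennreal ((f x - (\<Sum>j<m. (LINT y|w. f y * e j y) * e j x))\<^sup>2) \<partial>w \<partial>\<mu>) \<le> ennreal (2 * \<delta>\<^sup>2)"
    using exists_linear_approximation[OF adm less_imp_le[OF err]] by blast
  show ?thesis
  proof (cases "m = 0")
    case True
    have "min_err_sq d D \<rho> \<mu> (Lambda_std D) 0 \<le> ennreal (2 * \<delta>\<^sup>2)"
      using tail True by (simp add: min_err_sq_def)
    also have "\<dots> \<le> ennreal ((3 * \<delta>)\<^sup>2)"
      by (intro ennreal_leI) (simp add: power_mult_distrib)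
    finally show ?thesis by blast
  next
    case False
    have "min_err_sq d D \<rho> \<mu> (Lambda_std D) (32 * m^3) \<le> ennreal (3 * (2 * \<delta>\<^sup>2))"
      by (rule min_err_sq_std_le[OF _ _ e orth tail]) (use False \<delta> in auto)
    also have "\<dots> \<le> ennreal ((3 * \<delta>)\<^sup>2)"
      by (intro ennreal_leI) (simp add: power_mult_distrib)
    finally show ?thesis
      using m by (intro exI[of _ "32 * m^3"]) (auto intro: power_mono)
  qed
qed

end

subsection \<open>Information complexity\<close>

text \<open>Kept abstract in \<open>e1\<close> and \<open>e2\<close> so that both directions can use
  it. The accuracy \<open>\<epsilon> / 3\<close> costs only a factor \<open>3 powr \<alpha>\<close>
  in the denominator, the cube a factor 3 of the logarithm, and the constant an additive
  \<open>ln 32\<close>, negligible once the denominator is large.\<close>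

lemma ALG_UWT_transfer:
  assumes tr: "\<And>d \<delta> n. 1 \<le> d \<Longrightarrow> 0 < \<delta> \<Longrightarrow> e1 n d \<le> ennreal (\<delta>\<^sup>2) \<Longrightarrow> \<exists>N\<le>32 * n^3. e2 N d \<le> ennreal ((3 * \<delta>)\<^sup>2)"
    and U: "ALG_UWT e1"
  shows "ALG_UWT e2"
  unfolding ALG_UWT_def
proof (intro allI impI)
  fix \<alpha> \<beta> \<eta> :: real assume pos: "0 < \<alpha>" "0 < \<beta>" "0 < \<eta>"
  \<comment> \<open>The budget \<open>\<eta> * X\<close> is split into one half for
    \<open>ln 32\<close> and a sixth for each of the three copies of \<open>ln (real n1)\<close>;
    \<open>3 powr \<alpha>\<close> pays for the accuracy \<open>\<epsilon> / 3\<close>.\<close>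
  define \<eta>1 where "\<eta>1 = \<eta> / (6 * 3 powr \<alpha>)"
  have "0 < \<eta>1" using pos by (simp add: \<eta>1_def)
  then obtain M1 where M1: "\<And>d \<epsilon>. 1 \<le> d \<Longrightarrow> 0 < \<epsilon> \<Longrightarrow> \<epsilon> < 1 \<Longrightarrow> M1 < 1 / \<epsilon> + real d \<Longrightarrow>
      (\<exists>n. e1 n d \<le> ennreal (\<epsilon>\<^sup>2)) \<and> ln (real (n_ABS e1 \<epsilon> d)) / (\<epsilon> powr - \<alpha> + real d powr \<beta>) < \<eta>1"
    using U pos unfolding ALG_UWT_def by meson
  \<comment> \<open>From the value \<open>K\<close> of the denominator on, \<open>ln 32\<close> fits
    into its half of the budget. If the sum of \<open>1 / \<epsilon>\<close> and
    \<open>real d\<close> exceeds \<open>M2\<close>, one of them exceeds half of \<open>M2\<close>,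
    and its power alone reaches \<open>K\<close>.\<close>
  define K where "K = 2 * ln 32 / \<eta>"
  have K: "0 < K" using pos by (simp add: K_def)
  define M2 where "M2 = 2 * max (K powr (1 / \<alpha>)) (K powr (1 / \<beta>))"
  show "\<exists>M. \<forall>d\<ge>1. \<forall>\<epsilon>. 0 < \<epsilon> \<and> \<epsilon> < 1 \<and> M < 1 / \<epsilon> + real d \<longrightarrow>
      (\<exists>n. e2 n d \<le> ennreal (\<epsilon>\<^sup>2)) \<and> ln (real (n_ABS e2 \<epsilon> d)) / (\<epsilon> powr - \<alpha> + real d powr \<beta>) < \<eta>"
  proof (intro exI[of _ "max M1 M2"] allI impI)
    fix d :: nat and \<epsilon> :: real
    assume d: "1 \<le> d" and "0 < \<epsilon> \<and> \<epsilon> < 1 \<and> max M1 M2 < 1 / \<epsilon> + real d"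
    then have \<epsilon>: "0 < \<epsilon>" "\<epsilon> < 1" and M: "M1 < 1 / \<epsilon> + real d" "M2 < 1 / \<epsilon> + real d" by auto
    define X where "X = \<epsilon> powr - \<alpha> + real d powr \<beta>"
    have X: "0 < X" using \<epsilon> by (simp add: X_def add_pos_nonneg)
    have KX: "K \<le> X"
    proof -
      have "K powr (1 / \<alpha>) \<le> 1 / \<epsilon> \<or> K powr (1 / \<beta>) \<le> real d"
        using M(2) by (auto simp: M2_def)
      then show ?thesis
      proof
        assume "K powr (1 / \<alpha>) \<le> 1 / \<epsilon>"
        then have "(K powr (1 / \<alpha>)) powr \<alpha> \<le> (1 / \<epsilon>) powr \<alpha>"
          using pos by (intro powr_mono2) auto
        then have "K \<le> \<epsilon> powr - \<alpha>"
          using K pos \<epsilon> by (simp add: powr_powr powr_minus_divide powr_divide)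
        then show ?thesis by (simp add: X_def add_increasing2)
      next
        assume "K powr (1 / \<beta>) \<le> real d"
        then have "(K powr (1 / \<beta>)) powr \<beta> \<le> real d powr \<beta>"
          using pos by (intro powr_mono2) auto
        then have "K \<le> real d powr \<beta>"
          using K pos by (simp add: powr_powr)
        then show ?thesis by (simp add: X_def add_increasing)
      qed
    qed
    define n1 where "n1 = n_ABS e1 (\<epsilon> / 3) d"
    have "1 / \<epsilon> \<le> 1 / (\<epsilon> / 3)" using \<epsilon> by (simp add: field_simps)
    then have "M1 < 1 / (\<epsilon> / 3) + real d" using M(1) by linarith
    from M1[OF d _ _ this] \<epsilon> have ex: "\<exists>n. e1 n d \<le> ennreal ((\<epsilon> / 3)\<^sup>2)"
      and n1_lt: "ln (real n1) / ((\<epsilon> / 3) powr - \<alpha> + real d powr \<beta>) < \<eta>1"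
      by (auto simp: n1_def)
    from ex have "e1 n1 d \<le> ennreal ((\<epsilon> / 3)\<^sup>2)"
      unfolding n1_def n_ABS_def by (rule LeastI_ex)
    from tr[OF d _ this] \<epsilon> obtain N where N: "N \<le> 32 * n1^3" "e2 N d \<le> ennreal (\<epsilon>\<^sup>2)"
      by auto
    have le: "n_ABS e2 \<epsilon> d \<le> 32 * n1^3"
      using N unfolding n_ABS_def by (blast intro: order_trans[OF Least_le])
    have "ln (real (n_ABS e2 \<epsilon> d)) < \<eta> * X"
    proof (cases "n_ABS e2 \<epsilon> d = 0")
      \<comment> \<open>With the default value \<open>ln 0 = 0\<close> the bound is trivial
        here.\<close>
      case True
      then show ?thesis using pos X by simp
    next
      case False
      then have n1: "0 < n1" using le by (cases "n1 = 0") auto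
      have "real (n_ABS e2 \<epsilon> d) \<le> 32 * real n1 ^ 3"
        using of_nat_mono[OF le, where 'a = real] by simp
      then have "ln (real (n_ABS e2 \<epsilon> d)) \<le> ln (32 * real n1 ^ 3)"
        using False n1 by (intro ln_mono) auto
      also have "\<dots> = ln 32 + 3 * ln (real n1)"
        using n1 by (simp add: ln_mult ln_realpow)
      also have "ln 32 \<le> \<eta> * X / 2"
        using KX pos by (simp add: K_def field_simps)
      also have "ln (real n1) < \<eta> * X / 6"
      proof -
        have eq: "(\<epsilon> / 3) powr - \<alpha> = 3 powr \<alpha> * \<epsilon> powr - \<alpha>"
          using \<epsilon> by (simp add: powr_divide powr_minus_divide)
        have p: "0 < (\<epsilon> / 3) powr - \<alpha> + real d powr \<beta>"
          using \<epsilon> by (simp add: add_pos_nonneg)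
        have "ln (real n1) < \<eta>1 * ((\<epsilon> / 3) powr - \<alpha> + real d powr \<beta>)"
          using n1_lt p by (simp add: pos_divide_less_eq)
        also have "\<dots> \<le> \<eta>1 * (3 powr \<alpha> * X)"
        proof (intro mult_left_mono)
          have "1 * real d powr \<beta> \<le> 3 powr \<alpha> * real d powr \<beta>"
            using pos by (intro mult_right_mono ge_one_powr_ge_zero) auto
          then show "(\<epsilon> / 3) powr - \<alpha> + real d powr \<beta> \<le> 3 powr \<alpha> * X"
            unfolding eq X_def by (simp add: distrib_left)
        qed (use \<open>0 < \<eta>1\<close> in simp)
        also have "\<dots> = \<eta> * X / 6" by (simp add: \<eta>1_def)
        finally show ?thesis .
      qed
      finally show ?thesis by (simp add: mult.commute)
    qed
    then have "ln (real (n_ABS e2 \<epsilon> d)) / X < \<eta>"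
      using X by (simp add: pos_divide_less_eq)
    then show "(\<exists>n. e2 n d \<le> ennreal (\<epsilon>\<^sup>2)) \<and> ln (real (n_ABS e2 \<epsilon> d)) / (\<epsilon> powr - \<alpha> + real d powr \<beta>) < \<eta>"
      using N(2) by (auto simp: X_def)
  qed
qed

theorem theorem4p5:
  fixes D :: "nat \<Rightarrow> pt set"
    and \<rho> :: "nat \<Rightarrow> pt \<Rightarrow> real"
    and F :: "nat \<Rightarrow> fn set"
    and nF :: "nat \<Rightarrow> fn \<Rightarrow> real"
    and \<mu> :: "nat \<Rightarrow> fn measure"
  assumes "\<And>d. d \<ge> 1 \<Longrightarrow> avg_setting d (D d) (\<rho> d) (F d) (nF d) (\<mu> d)"
  shows "ALG_UWT (\<lambda>n d. min_err_sq d (D d) (\<rho> d) (\<mu> d) (Lambda_all (F d) (nF d)) n)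
     \<longleftrightarrow> ALG_UWT (\<lambda>n d. min_err_sq d (D d) (\<rho> d) (\<mu> d) (Lambda_std (D d)) n)"
    (is "ALG_UWT ?all \<longleftrightarrow> ALG_UWT ?std")
proof
  have ac: "average_case d (D d) (\<rho> d) (F d) (nF d) (\<mu> d)" if "1 \<le> d" for d
    using assms[OF that] by (rule average_case.intro)
  show "ALG_UWT ?std" if "ALG_UWT ?all"
    using average_case.min_err_sq_std_of_all[OF ac] by (intro ALG_UWT_transfer[OF _ that]) blast
  show "ALG_UWT ?all" if "ALG_UWT ?std"
  proof (rule ALG_UWT_transfer[OF _ that])
    fix d n :: nat and \<delta> :: real
    assume d: "1 \<le> d" and \<delta>: "0 < \<delta>" and le: "?std n d \<le> ennreal (\<delta>\<^sup>2)"
    \<comment> \<open>Samples are special functionals, so \<open>N = n\<close> works with no loss of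
      accuracy; the weaker bounds only match the form of the transfer lemma.\<close>
    have "n \<le> n^3" by (cases n) (auto simp: power3_eq_cube)
    then have "n \<le> 32 * n^3" by simp
    moreover have "?all n d \<le> ennreal ((3 * \<delta>)\<^sup>2)"
    proof -
      have "?all n d \<le> ?std n d" by (rule average_case.min_err_sq_all_le_std[OF ac[OF d]])
      also note le
      also have "ennreal (\<delta>\<^sup>2) \<le> ennreal ((3 * \<delta>)\<^sup>2)"
        using \<delta> by (intro ennreal_leI power_mono) auto
      finally show ?thesis .
    qed
    ultimately show "\<exists>N\<le>32 * n^3. ?all N d \<le> ennreal ((3 * \<delta>)\<^sup>2)" by blast
  qed
qed

end
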